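(* (a) For each $i\ge1$ let $x_i,y_i,A_i,B_i$ be complex numbers with $A_i,B_i\neq0$, and let $\mathfrak S^*_{\lambda/\mu}$ be the six-vertex model of the context with row-$i$ weights $$\mathtt a_1^{(i)}=A_i^{-1},\ \mathtt a_2^{(i)}=x_iA_i^{-1}B_i^{-1},\ \mathtt b_1^{(i)}=A_i^{-1}B_i^{-1},\ \mathtt b_2^{(i)}=y_iA_i^{-1},\ \mathtt c_1^{(i)}=(x_i+y_i)A_i^{-1},\ \mathtt c_2^{(i)}=A_i^{-1}B_i^{-1}.$$ Then complex parameters $s_{-k}^{(j)}$ ($k,j\ge1$) satisfy $$Z(\mathfrak S^*_{\lambda/\mu})=\prod_{i=1}^NA_i^{-(M+1)}B_i^{-\ell(\lambda)}\cdot\langle\lambda|e^{H_-}|\mu\rangle\quad\text{for all strict partitions }\lambda,\mu\text{, all }N\ge1\text{ and all }M\ge\max(\lambda_1,\mu_1)$$ if and only if $$s_{-k}^{(j)}=\frac1k\left(y_j^k+(-1)^{k-1}x_j^k\right)\quad\text{for all }k\ge1,\ j\ge1.$$ (b) Let instead the row weights $\mathtt a_1^{(i)},\mathtt a_2^{(i)},\mathtt b_1^{(i)},\mathtt b_2^{(i)},\mathtt c_1^{(i)},\mathtt c_2^{(i)}$ ($i\ge 1$) be arbitrary nonzero complex numbers, and define $A_i,B_i$ by $\mathtt a_1^{(i)}=A_i^{-1}$, $\mathtt b_1^{(i)}=A_i^{-1}B_i^{-1}$. If the weights are not free fermionic, i.e. $\mathtt a_1^{(i)}\mathtt a_2^{(i)}+\mathtt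 b_1^{(i)}\mathtt b_2^{(i)}\ne\mathtt c_1^{(i)}\mathtt c_2^{(i)}$ for some $i$, then there is no choice of the parameters $s_{-k}^{(j)}$ for which the identity $Z=\prod_{i=1}^NA_i^{-(M+1)}B_i^{-\ell(\lambda)}\langle\lambda|e^{H_-}|\mu\rangle$ holds for all strict partitions $\lambda,\mu$ and all $M,N$.
   Context: A strict partition is $\lambda=(\lambda_1>\dots>\lambda_\ell\ge0)$, $\ell=\ell(\lambda)$ its length (a part $0$ is allowed and counted). Fock space. Basis: semi-infinite wedges $u_{m_1}\wedge u_{m_2}\wedge\cdots$ with integers $m_1>m_2>\cdots$ such that, for some integer $c$, $m_r=c-r$ for all large $r$; $u_a\wedge u_b=-u_b\wedge u_a$. $|\lambda\rangle=u_{\lambda_1}\wedge\dots\wedge u_{\lambda_\ell}\wedge u_{-1}\wedge u_{-2}\wedge\cdots$; $\langle\lambda|X|\mu\rangle$ is the coefficient of $|\lambda\rangle$ in $X|\mu\rangle$. For $k\ne 0$, $J_k(u_{m_1}\wedge u_{m_2}\wedge\cdots)=\sum_{i\ge1}u_{m_1}\wedge\dots\wedge u_{m_i-k}\wedge\cdots$ (only the $i$th factor changed). For given $N$, $H_-=\sum_{k\ge1}\sum_{j=1}^Ns_{-k}^{(j)}J_{-k}$, $e^{H_-}=\sum_{m\ge0}H_-^m/m!$ (each matrix coefficient is a finite sum). Lattice model (indexed by strict $\lambda,\mu$). Grid with $N$ rows labelled $1,\dots,N$ from top to bottom, $M+1$ columns labelled $0,\dots,M$ from left to right, $M\ge\max(\lambda_1,\mu_1)$;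 edges carry spins $\pm$; left and right boundary edges all $+$; bottom boundary edges $-$ exactly on parts of $\mu$; top boundary edges $-$ exactly on parts of $\lambda$. Admissible vertices in row $i$, written (left, top, right, bottom): $\mathtt a_1^{(i)}=(+,+,+,+)$, $\mathtt a_2^{(i)}=(-,-,-,-)$, $\mathtt b_1^{(i)}=(+,-,+,-)$, $\mathtt b_2^{(i)}=(-,+,-,+)$, $\mathtt c_1^{(i)}=(+,+,-,-)$, $\mathtt c_2^{(i)}=(-,-,+,+)$; the same symbols denote weights; other vertices have weight $0$. $Z$ is the sum over spin assignments to interior edges of the product of vertex weights. *)

theory Defs
  imports Complex_Main "HOL-Library.FuncSet" "HOL-Library.Groups_Big_Fun"
    "HOL-Combinatorics.Permutations"
begin

section \<open>Strict partitions\<close>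

definition strict_partition :: "nat list \<Rightarrow> bool" where
  "strict_partition lam \<longleftrightarrow> sorted_wrt (>) lam"

definition largest_part :: "nat list \<Rightarrow> nat" where
  "largest_part lam = (case lam of [] \<Rightarrow> 0 | p # _ \<Rightarrow> p)"


section \<open>Fock space\<close>

text \<open>Factors are indexed from 0: the sequence m stands for the wedge of
  u_(m 0), u_(m 1), u_(m 2), ... .\<close>

definition wedge_basis :: "(nat \<Rightarrow> int) set" where
  "wedge_basis = {m. strict_antimono_on UNIV m \<and>
     (\<exists>c. eventually (\<lambda>r. m r = c - int r) sequentially)}"

text \<open>A vector is given by its coefficients on \<^const>\<open>wedge_basis\<close> and vanishes
  elsewhere.  Infinite formal combinations are permitted, because the image of a basis vector
  under the half-infinite sum of the operators J_(-k) is one.\<close>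

type_synonym fock = "(nat \<Rightarrow> int) \<Rightarrow> complex"

text \<open>The wedge of an unordered sequence m, straightened by antisymmetry: it is the sign of the
  (unique) finitary permutation sorting m into a basis sequence, times that basis vector; if a
  factor is repeated there is no such permutation and the wedge is 0.\<close>

definition wedge :: "(nat \<Rightarrow> int) \<Rightarrow> fock" where
  "wedge m = (\<lambda>n. if n \<in> wedge_basis \<and> (\<exists>p. permutation p \<and> m = n \<circ> p)
     then of_int (sign (THE p. permutation p \<and> m = n \<circ> p)) else 0)"

definition partition_seq :: "nat list \<Rightarrow> nat \<Rightarrow> int" where
  "partition_seq lam r =
     (if r < length lam then int (lam ! r) else - int (r - length lam) - 1)"

definition ket :: "nat list \<Rightarrow> fock" where
  "ket lam = wedge (partition_seq lam)"

definition bracket :: "nat list \<Rightarrow> (fock \<Rightarrow> fock) \<Rightarrow> nat list \<Rightarrow> complex" where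
  "bracket lam X mu = X (ket mu) (partition_seq lam)"

text \<open>\<^const>\<open>Sum_any\<close> is the sum of a function over its support, and is 0 if the support is
  infinite.  Below all supports are finite: for fixed m, n and nonzero k, only finitely many i
  give a wedge that is not 0; for fixed n there are only finitely many basis sequences m and
  k \<ge> 1 such that n occurs in J_(-k) applied to m; and since J_(-k) raises the energy by k,
  a fixed n occurs in only finitely many powers of H_- applied to a basis vector.
  (J is meant for nonzero k; for positive k it is meant for finite combinations only.)\<close>

definition J :: "int \<Rightarrow> fock \<Rightarrow> fock" where
  "J k v = (\<lambda>n. Sum_any (\<lambda>m. v m * Sum_any (\<lambda>i. wedge (m(i := m i - k)) n)))"

text \<open>The parameter s_(-k)^(j) is written \<open>s k j\<close>, for k, j \<ge> 1.\<close>

definition H_minus :: "(nat \<Rightarrow> nat \<Rightarrow> complex) \<Rightarrow> nat \<Rightarrow> fock \<Rightarrow> fock" where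
  "H_minus s N v = (\<lambda>n. Sum_any (\<lambda>k::nat.
     if k \<ge> 1 then (\<Sum>j=1..N. s k j * J (- int k) v n) else 0))"

definition exp_H_minus :: "(nat \<Rightarrow> nat \<Rightarrow> complex) \<Rightarrow> nat \<Rightarrow> fock \<Rightarrow> fock" where
  "exp_H_minus s N v = (\<lambda>n. Sum_any (\<lambda>p::nat. (H_minus s N ^^ p) v n / fact p))"


section \<open>The six-vertex model\<close>

datatype spin = Plus | Minus

datatype row_weights = Row_Weights
  (wa1: complex) (wa2: complex) (wb1: complex) (wb2: complex) (wc1: complex) (wc2: complex)

text \<open>The arguments are the spins of the left, top, right and bottom edge.\<close>

fun vertex_weight :: "row_weights \<Rightarrow> spin \<Rightarrow> spin \<Rightarrow> spin \<Rightarrow> spin \<Rightarrow> complex" where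
  "vertex_weight w Plus  Plus  Plus  Plus  = wa1 w"
| "vertex_weight w Minus Minus Minus Minus = wa2 w"
| "vertex_weight w Plus  Minus Plus  Minus = wb1 w"
| "vertex_weight w Minus Plus  Minus Plus  = wb2 w"
| "vertex_weight w Plus  Plus  Minus Minus = wc1 w"
| "vertex_weight w Minus Minus Plus  Plus  = wc2 w"
| "vertex_weight w _     _     _     _     = 0"

definition part_spin :: "nat list \<Rightarrow> nat \<Rightarrow> spin" where
  "part_spin lam j = (if j \<in> set lam then Minus else Plus)"

text \<open>In a state \<open>(h, v)\<close>, the vertex in row i (from 1 to N) and column j (from 0 to M) has left
  edge \<open>h (i, j)\<close>, right edge \<open>h (i, j + 1)\<close>, top edge \<open>v (i - 1, j)\<close> and bottom edge
  \<open>v (i, j)\<close>.  Boundary edges have prescribed spins, so states correspond to spin assignments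
  to the interior edges.\<close>

definition lattice_states ::
  "nat \<Rightarrow> nat \<Rightarrow> nat list \<Rightarrow> nat list \<Rightarrow> ((nat \<times> nat \<Rightarrow> spin) \<times> (nat \<times> nat \<Rightarrow> spin)) set" where
  "lattice_states N M lam mu = {(h, v).
     h \<in> ({1..N} \<times> {0..M + 1}) \<rightarrow>\<^sub>E UNIV \<and>
     v \<in> ({0..N} \<times> {0..M}) \<rightarrow>\<^sub>E UNIV \<and>
     (\<forall>i\<in>{1..N}. h (i, 0) = Plus \<and> h (i, M + 1) = Plus) \<and>
     (\<forall>j\<in>{0..M}. v (0, j) = part_spin lam j \<and> v (N, j) = part_spin mu j)}"

definition partition_function ::
  "(nat \<Rightarrow> row_weights) \<Rightarrow> nat \<Rightarrow> nat \<Rightarrow> nat list \<Rightarrow> nat list \<Rightarrow> complex" where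
  "partition_function W N M lam mu =
     (\<Sum>(h, v)\<in>lattice_states N M lam mu. \<Prod>i=1..N. \<Prod>j=0..M.
        vertex_weight (W i) (h (i, j)) (v (i - 1, j)) (h (i, j + 1)) (v (i, j)))"

definition free_fermionic :: "row_weights \<Rightarrow> bool" where
  "free_fermionic w \<longleftrightarrow> wa1 w * wa2 w + wb1 w * wb2 w = wc1 w * wc2 w"

definition all_weights_nonzero :: "row_weights \<Rightarrow> bool" where
  "all_weights_nonzero w \<longleftrightarrow>
     wa1 w \<noteq> 0 \<and> wa2 w \<noteq> 0 \<and> wb1 w \<noteq> 0 \<and> wb2 w \<noteq> 0 \<and> wc1 w \<noteq> 0 \<and> wc2 w \<noteq> 0"

definition ff_weights :: "complex \<Rightarrow> complex \<Rightarrow> complex \<Rightarrow> complex \<Rightarrow> row_weights" where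
  "ff_weights x y A B = Row_Weights
     (inverse A) (x * inverse A * inverse B) (inverse A * inverse B) (y * inverse A)
     ((x + y) * inverse A) (inverse A * inverse B)"

end

theory Submission
  imports Defs "HOL-Computational_Algebra.Polynomial"
    "HOL-Computational_Algebra.Formal_Power_Series"
begin

text \<open>
  Both sides are computed by one determinant. Exponentiating \<open>H_-\<close> acts factor by factor on a
  wedge, so \<open>\<langle>\<lambda>|e\<^sup>H|\<mu>\<rangle> = det h(\<lambda>_i - \<mu>_j)\<close>, where the \<open>h(k)\<close> have generating function
  \<open>exp (\<Sum>k. (\<Sum>j\<le>N. s_(-k)^(j)) X\<^sup>k)\<close>. On the lattice, summing over a row column by column is
  multilinear algebra in such a determinant: an arriving particle and a resting one wedge to
  \<open>c\<^sub>1 c\<^sub>2 - b\<^sub>1 b\<^sub>2\<close> times the swapped pair, which matches the weight \<open>a\<^sub>1 a\<^sub>2\<close> exactly in the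
  free fermionic case, and each row multiplies the generating function by
  \<open>(1 + x X) / (1 - y X)\<close>. Taking logarithms gives the parameters. For general weights, let \<open>e\<close> be
  the matrix coefficient from \<open>\<mu> = (1,0)\<close> to \<open>\<lambda> = (2,1)\<close>; the determinant forces
  \<open>h(1)\<^sup>2 = h(2) + e\<close>, and the increment of this identity when a row is added is the free
  fermionic equation for that row.
\<close>

section \<open>Leibniz determinants\<close>

definition int_coeff :: "'a::zero fps \<Rightarrow> int \<Rightarrow> 'a" where
  "int_coeff H k = (if k < 0 then 0 else fps_nth H (nat k))"

text \<open>Entries are functions of indices and the ring is arbitrary: sizes vary with the
  partition, a row is replaced by function update, and the entries may be polynomials.\<close>

definition leibniz_det :: "nat \<Rightarrow> (nat \<Rightarrow> nat \<Rightarrow> 'a::comm_ring_1) \<Rightarrow> 'a" where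
  "leibniz_det n f = (\<Sum>p | p permutes {..<n}. of_int (sign p) * (\<Prod>i<n. f i (p i)))"

lemma leibniz_det_cong:
  assumes "\<And>i j. i < n \<Longrightarrow> j < n \<Longrightarrow> f i j = g i j"
  shows "leibniz_det n f = leibniz_det n g"
  unfolding leibniz_det_def
proof (intro sum.cong refl arg_cong2[where f = "(*)"] prod.cong)
  fix p i assume "p \<in> {p. p permutes {..<n}}" "i \<in> {..<n}"
  then show "f i (p i) = g i (p i)"
    using assms[of i "p i"] permutes_in_image[of p "{..<n}" i] by auto
qed

lemma leibniz_det_permute:
  assumes q: "q permutes {..<n}"
  shows "leibniz_det n (\<lambda>i. f (q i)) = of_int (sign q) * leibniz_det n f"
proof -
  have "leibniz_det n (\<lambda>i. f (q i)) =
      (\<Sum>p | p permutes {..<n}. of_int (sign (p \<circ> q)) * (\<Prod>i<n. f (q i) ((p \<circ> q) i)))"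
    unfolding leibniz_det_def by (rule sum_permutations_compose_right[OF q])
  also have "\<dots> = (\<Sum>p | p permutes {..<n}. of_int (sign q) * (of_int (sign p) * (\<Prod>i<n. f i (p i))))"
  proof (rule sum.cong[OF refl])
    fix p assume "p \<in> {p. p permutes {..<n}}"
    then have p: "p permutes {..<n}" by simp
    have "sign (p \<circ> q) = sign p * sign q"
      using p q by (intro sign_compose) (auto intro: permutes_imp_permutation)
    moreover have "(\<Prod>i<n. f (q i) ((p \<circ> q) i)) = (\<Prod>i<n. f i (p i))"
      using prod.permute[OF q, of "\<lambda>i. f i (p i)"] by (simp add: o_def)
    ultimately show "of_int (sign (p \<circ> q)) * (\<Prod>i<n. f (q i) ((p \<circ> q) i)) =
        of_int (sign q) * (of_int (sign p) * (\<Prod>i<n. f i (p i)))"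
      by simp
  qed
  finally show ?thesis by (simp add: leibniz_det_def sum_distrib_left)
qed

lemma leibniz_det_transpose: "leibniz_det n (\<lambda>i j. f j i) = leibniz_det n f"
proof -
  have "leibniz_det n (\<lambda>i j. f j i) =
      (\<Sum>p | p permutes {..<n}. of_int (sign (inv p)) * (\<Prod>i<n. f (inv p i) i))"
    unfolding leibniz_det_def by (rule sum_permutations_inverse)
  also have "\<dots> = leibniz_det n f"
    unfolding leibniz_det_def
  proof (rule sum.cong[OF refl])
    fix p assume "p \<in> {p. p permutes {..<n}}"
    then have p: "p permutes {..<n}" by simp
    have "(\<Prod>i<n. f (inv p i) i) = (\<Prod>i<n. f (inv p (p i)) (p i))"
      using prod.permute[OF p, of "\<lambda>i. f (inv p i) i"] by (simp add: o_def)
    also have "\<dots> = (\<Prod>i<n. f i (p i))" using permutes_inverses[OF p] by simp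
    finally show "of_int (sign (inv p)) * (\<Prod>i<n. f (inv p i) i) =
        of_int (sign p) * (\<Prod>i<n. f i (p i))"
      using sign_inverse[OF permutes_imp_permutation[OF _ p]] by simp
  qed
  finally show ?thesis .
qed

text \<open>Exchanging the equal rows fixes the matrix and negates the determinant; characteristic 0
  turns \<open>d = - d\<close> into \<open>d = 0\<close>.\<close>

lemma leibniz_det_eq_rows:
  fixes f :: "nat \<Rightarrow> nat \<Rightarrow> 'a::{idom, ring_char_0}"
  assumes "i < n" "j < n" "i \<noteq> j" "f i = f j"
  shows "leibniz_det n f = 0"
proof -
  have "(\<lambda>k. f (transpose i j k)) = f"
    using assms(4) by (auto simp: fun_eq_iff transpose_def)
  then have "leibniz_det n f = - leibniz_det n f"
    using leibniz_det_permute[OF permutes_swap_id, of i n j f] assms by (simp add: sign_swap_id)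
  then show ?thesis by simp
qed

lemma leibniz_det_zero_row:
  assumes "i < n" "\<And>j. j < n \<Longrightarrow> f i j = 0"
  shows "leibniz_det n f = 0"
  unfolding leibniz_det_def
proof (rule sum.neutral, rule)
  fix p assume "p \<in> {p. p permutes {..<n}}"
  then have "f i (p i) = 0" using assms permutes_in_image[of p "{..<n}" i] by auto
  then have "(\<Prod>i<n. f i (p i)) = 0" using assms(1) by (intro prod_zero) auto
  then show "of_int (sign p) * (\<Prod>i<n. f i (p i)) = 0" by simp
qed

lemma leibniz_det_linear_row:
  assumes "k < n"
  shows "leibniz_det n (f(k := \<lambda>j. c * v j + d * w j)) =
    c * leibniz_det n (f(k := v)) + d * leibniz_det n (f(k := w))"
proof -
  \<comment> \<open>The remaining product does not involve row \<open>k\<close>, so each Leibniz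
    term is linear in that row.\<close>
  have split: "(\<Prod>i<n. (f(k := u)) i (p i)) = u (p k) * (\<Prod>i\<in>{..<n} - {k}. f i (p i))" for u p
    using assms by (simp add: prod.remove[of _ k])
  show ?thesis
    unfolding leibniz_det_def split by (simp add: sum_distrib_left sum.distrib[symmetric] algebra_simps)
qed

lemma leibniz_det_1: "leibniz_det (Suc 0) f = f 0 0"
  by (simp add: leibniz_det_def lessThan_Suc)

lemma leibniz_det_2: "leibniz_det 2 f = f 0 0 * f 1 1 - f 0 1 * f 1 0"
proof -
  have [simp]: "{..<2} = {0, Suc 0}" by auto
  have "{p. p permutes {0, Suc 0}} = {id, transpose 0 (Suc 0)}"
    by (auto simp: permutes_doubleton_iff)
  moreover have "id \<noteq> transpose 0 (Suc 0)"
    by (metis id_apply transpose_apply_first n_not_Suc_n)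
  ultimately show ?thesis by (simp add: leibniz_det_def sign_swap_id)
qed

section \<open>Derivatives and row expansions of determinants\<close>

lemma pderiv_sum: "pderiv (\<Sum>i\<in>A. f i) = (\<Sum>i\<in>A. pderiv (f i))"
  by (induction A rule: infinite_finite_induct) (simp_all add: pderiv_add)

text \<open>Product rule, grouped by rows. This form matches a current operator, which changes one
  wedge factor at a time.\<close>

lemma pderiv_leibniz_det:
  "pderiv (leibniz_det n f) = (\<Sum>i<n. leibniz_det n (f(i := \<lambda>j. pderiv (f i j))))"
proof -
  have step: "pderiv (of_int z * p) = of_int z * pderiv p" for z and p :: "'a poly"
    by (simp add: of_int_poly pderiv_smult)
  have "pderiv (leibniz_det n f) = (\<Sum>p | p permutes {..<n}.
      \<Sum>i<n. of_int (sign p) * (pderiv (f i (p i)) * (\<Prod>k\<in>{..<n} - {i}. f k (p k))))"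
    unfolding leibniz_det_def pderiv_sum step pderiv_prod sum_distrib_left by (simp add: mult.commute)
  also have "\<dots> = (\<Sum>i<n. \<Sum>p | p permutes {..<n}.
      of_int (sign p) * (pderiv (f i (p i)) * (\<Prod>k\<in>{..<n} - {i}. f k (p k))))"
    by (rule sum.swap)
  also have "\<dots> = (\<Sum>i<n. leibniz_det n (f(i := \<lambda>j. pderiv (f i j))))"
    unfolding leibniz_det_def by (intro sum.cong refl) (simp add: prod.remove)
  finally show ?thesis .
qed

lemma leibniz_det_sum_row:
  assumes "k < n"
  shows "leibniz_det n (f(k := \<lambda>j. \<Sum>l\<in>L. c l * v l j)) =
    (\<Sum>l\<in>L. c l * leibniz_det n (f(k := v l)))"
proof -
  have split: "(\<Prod>i<n. (f(k := u)) i (p i)) = u (p k) * (\<Prod>i\<in>{..<n} - {k}. f i (p i))" for u p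
    using assms by (simp add: prod.remove[of _ k])
  have "leibniz_det n (f(k := \<lambda>j. \<Sum>l\<in>L. c l * v l j)) =
      (\<Sum>p | p permutes {..<n}. \<Sum>l\<in>L. c l * (of_int (sign p) *
        (v l (p k) * (\<Prod>i\<in>{..<n} - {k}. f i (p i)))))"
    unfolding leibniz_det_def split sum_distrib_left sum_distrib_right
    by (intro sum.cong refl) (simp add: ac_simps)
  also have "\<dots> = (\<Sum>l\<in>L. c l * leibniz_det n (f(k := v l)))"
    unfolding leibniz_det_def split sum_distrib_left by (rule sum.swap)
  finally show ?thesis .
qed

lemma poly_leibniz_det: "poly (leibniz_det n f) z = leibniz_det n (\<lambda>i j. poly (f i j) z)"
  by (simp add: leibniz_det_def poly_sum poly_prod)

section \<open>Wedges and partitions\<close>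

text \<open>By surjectivity \<open>p\<close> maps \<open>{..<n}\<close> onto
  \<open>{..<p n}\<close>; comparing cardinalities gives \<open>p n = n\<close>.\<close>

lemma strict_mono_perm_id:
  fixes p :: "nat \<Rightarrow> nat"
  assumes "strict_mono p" "bij p"
  shows "p = id"
proof
  fix n
  have "card (p ` {..<n}) = card {..<p n}"
  proof -
    have "p ` {..<n} = {..<p n}"
    proof
      show "p ` {..<n} \<subseteq> {..<p n}" using assms(1) by (auto simp: strict_mono_less)
      show "{..<p n} \<subseteq> p ` {..<n}"
      proof
        fix k assume "k \<in> {..<p n}"
        moreover obtain i where "k = p i" using bij_is_surj[OF assms(2)] by (metis surjD)
        ultimately show "k \<in> p ` {..<n}" using assms(1) by (auto simp: strict_mono_less)
      qed
    qed
    then show ?thesis by simp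
  qed
  then show "p n = id n"
    using card_image[OF inj_on_subset[OF bij_is_inj[OF assms(2)]], of "{..<n}"] by simp
qed

abbreviation decr_seq :: "(nat \<Rightarrow> int) \<Rightarrow> bool" where
  "decr_seq m \<equiv> strict_antimono_on UNIV m"

lemma decr_seq_iff: "decr_seq m \<longleftrightarrow> (\<forall>i j. i < j \<longrightarrow> m j < m i)"
  by (auto simp: monotone_on_def)

lemma decr_seq_less: "decr_seq m \<Longrightarrow> m i < m j \<longleftrightarrow> j < i"
  by (metis decr_seq_iff linorder_neqE_nat order_less_asym order_less_irrefl)

lemma decr_seq_inj: "decr_seq m \<Longrightarrow> inj m"
  by (metis decr_seq_less injI linorder_neqE_nat order_less_irrefl)

text \<open>Both sequences decrease, so \<open>p\<close> preserves the order of indices.\<close>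

lemma decr_seq_perm_unique:
  assumes "decr_seq m" "decr_seq n" "m = n \<circ> p" "bij p"
  shows "p = id"
proof (rule strict_mono_perm_id[OF _ assms(4)])
  show "strict_mono p"
  proof
    fix i j :: nat assume "i < j"
    then have "m j < m i" using assms(1) decr_seq_less by blast
    then show "p i < p j" using assms(2,3) decr_seq_less by auto
  qed
qed

section \<open>Sequences attached to strict partitions\<close>

lemma strict_partition_nth_less:
  "strict_partition lam \<Longrightarrow> i < j \<Longrightarrow> j < length lam \<Longrightarrow> lam ! j < lam ! i"
  by (simp add: strict_partition_def sorted_wrt_iff_nth_less)

lemma partition_seq_nth: "i < length lam \<Longrightarrow> partition_seq lam i = int (lam ! i)"
  by (simp add: partition_seq_def)

lemma partition_seq_nonneg_iff: "partition_seq lam i \<ge> 0 \<longleftrightarrow> i < length lam"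
  by (simp add: partition_seq_def)

lemma partition_seq_decr: "strict_partition lam \<Longrightarrow> decr_seq (partition_seq lam)"
  by (auto simp: decr_seq_iff partition_seq_def strict_partition_nth_less)

lemma partition_seq_basis:
  assumes "strict_partition lam"
  shows "partition_seq lam \<in> wedge_basis"
proof -
  have "\<forall>r\<ge>length lam. partition_seq lam r = (int (length lam) - 1) - int r"
    by (auto simp: partition_seq_def)
  then show ?thesis
    using partition_seq_decr[OF assms] unfolding wedge_basis_def eventually_sequentially by blast
qed

text \<open>The length is recovered as the number of nonnegative entries, so a part 0 is not
  lost.\<close>

lemma partition_seq_eqD:
  assumes "partition_seq lam = partition_seq mu"
  shows "lam = mu"
proof -
  have "i < length lam \<longleftrightarrow> i < length mu" for i
    using assms by (metis partition_seq_nonneg_iff)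
  then have len: "length lam = length mu" by (meson linorder_neqE_nat order_less_irrefl)
  show ?thesis
  proof (rule nth_equalityI[OF len])
    fix i assume "i < length lam"
    then show "lam ! i = mu ! i"
      using fun_cong[OF assms, of i] len by (simp add: partition_seq_nth)
  qed
qed

lemma wedge_basis_decr: "m \<in> wedge_basis \<Longrightarrow> decr_seq m"
  by (simp add: wedge_basis_def)

text \<open>\<open>n\<close> is injective, so \<open>n \<circ> p\<close> determines \<open>p\<close>
  and the \<open>THE\<close> in \<open>wedge\<close> picks \<open>p\<close>.\<close>

lemma wedge_permute:
  assumes "n \<in> wedge_basis" "permutation p"
  shows "wedge (n \<circ> p) n = of_int (sign p)"
proof -
  have "(THE p'. permutation p' \<and> n \<circ> p = n \<circ> p') = p"
  proof (rule the_equality)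
    fix p' assume "permutation p' \<and> n \<circ> p = n \<circ> p'"
    then show "p' = p"
      using decr_seq_inj[OF wedge_basis_decr[OF assms(1)]]
      by (metis inj_def fun_eq_iff o_apply)
  qed (use assms in auto)
  then show ?thesis using assms by (auto simp: wedge_def)
qed

lemma wedge_nonzeroE:
  assumes "wedge m n \<noteq> 0"
  obtains p where "n \<in> wedge_basis" "permutation p" "m = n \<circ> p"
  using assms by (auto simp: wedge_def split: if_splits)

lemma ket_partition_seq:
  assumes "strict_partition lam" "strict_partition mu"
  shows "ket mu (partition_seq lam) = (if lam = mu then 1 else 0)"
proof (cases "lam = mu")
  case True
  then show ?thesis
    using wedge_permute[OF partition_seq_basis[OF assms(1)] permutation_id]
    by (simp add: ket_def sign_id)
next
  case False
  have "ket mu (partition_seq lam) = 0"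
  proof (rule ccontr)
    assume "ket mu (partition_seq lam) \<noteq> 0"
    then obtain p where p: "permutation p" "partition_seq mu = partition_seq lam \<circ> p"
      unfolding ket_def by (auto elim: wedge_nonzeroE)
    then have "p = id"
      using decr_seq_perm_unique[OF partition_seq_decr[OF assms(2)] partition_seq_decr[OF assms(1)]]
        permutation_bijective by blast
    then show False using p partition_seq_eqD False by auto
  qed
  then show ?thesis using False by simp
qed

lemma ket_outside: "m \<notin> wedge_basis \<Longrightarrow> ket mu m = 0"
  by (simp add: ket_def wedge_def)

text \<open>A nonzero Leibniz term matches each part of \<open>lam\<close> with an equal part of
  \<open>mu\<close>. Extended by the identity on the common tail, the matching relates two
  decreasing sequences, so it is the identity. This is the case of generating function 1 on both
  sides of the theorem.\<close>

lemma leibniz_det_delta: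
  assumes "strict_partition lam" "strict_partition mu" "length lam = n" "length mu = n"
  shows "leibniz_det n (\<lambda>i j. if lam ! i = mu ! j then 1 else 0) = (if lam = mu then 1 else 0)"
proof -
  have zero: "p = id \<and> lam = mu"
    if p: "p permutes {..<n}" and nz: "(\<Prod>i<n. if lam ! i = mu ! p i then 1 else 0::'a) \<noteq> 0" for p
  proof -
    have *: "lam ! i = mu ! p i" if "i < n" for i
    proof (rule ccontr)
      assume "lam ! i \<noteq> mu ! p i"
      then have "(\<Prod>i<n. if lam ! i = mu ! p i then 1 else 0::'a) = 0"
        using that by (intro prod_zero) auto
      then show False using nz by simp
    qed
    have "partition_seq lam = partition_seq mu \<circ> p"
    proof
      fix i
      show "partition_seq lam i = (partition_seq mu \<circ> p) i"
      proof (cases "i < n")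
        case True
        then have "p i < n" using permutes_in_image[OF p, of i] by simp
        then show ?thesis using True *[OF True] assms by (simp add: partition_seq_nth)
      next
        case False
        then have "p i = i" using permutes_not_in[OF p] by simp
        then show ?thesis using False assms by (simp add: partition_seq_def)
      qed
    qed
    then have "p = id"
      using decr_seq_perm_unique[OF partition_seq_decr[OF assms(1)] partition_seq_decr[OF assms(2)]]
        permutes_bij[OF p] by blast
    then show ?thesis
      using partition_seq_eqD \<open>partition_seq lam = partition_seq mu \<circ> p\<close> by simp
  qed
  have "leibniz_det n (\<lambda>i j. if lam ! i = mu ! j then 1 else 0) =
      (\<Sum>p\<in>{id}. of_int (sign p) * (\<Prod>i<n. if lam ! i = mu ! p i then 1 else 0::'a))"
    unfolding leibniz_det_def
  proof (intro sum.mono_neutral_right ballI)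
    fix p assume "p \<in> {p. p permutes {..<n}} - {id}"
    then have "(\<Prod>i<n. if lam ! i = mu ! p i then 1 else 0::'a) = 0" using zero[of p] by auto
    then show "of_int (sign p) * (\<Prod>i<n. if lam ! i = mu ! p i then 1 else 0::'a) = 0" by simp
  qed (auto simp: permutes_id finite_permutations)
  also have "\<dots> = (if lam = mu then 1 else 0)"
    using zero[of id] by (auto simp: permutes_id)
  finally show ?thesis .
qed

section \<open>The current operators on wedges of partitions\<close>

lemma sort_decr:
  fixes a :: "nat \<Rightarrow> int"
  assumes inj: "inj_on a {..<l}" and nonneg: "\<And>i. i < l \<Longrightarrow> a i \<ge> 0"
  obtains q lam where "q permutes {..<l}" "strict_partition lam" "length lam = l"
    "\<And>i. i < l \<Longrightarrow> int (lam ! i) = a (q i)"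
proof -
  define xs where "xs = map (nat \<circ> a) [0..<l]"
  define lam where "lam = rev (sorted_list_of_set (set xs))"
  have "inj_on (nat \<circ> a) {..<l}"
    using inj nonneg by (auto simp: inj_on_def) (metis lessThan_iff nat_0_le)
  then have "distinct xs" by (simp add: xs_def distinct_map atLeast0LessThan)
  then have ms: "mset lam = mset xs"
    by (metis lam_def mset_rev set_eq_iff_mset_eq_distinct distinct_sorted_list_of_set
        finite_set set_sorted_list_of_set)
  then obtain q where q: "q permutes {..<length xs}" "permute_list q xs = lam"
    by (rule mset_eq_permutation)
  show thesis
  proof (rule that)
    show "q permutes {..<l}" using q by (simp add: xs_def)
    show "strict_partition lam"
      by (simp add: strict_partition_def lam_def sorted_wrt_rev)
    show "length lam = l" using ms by (metis length_map length_upt mset_eq_length minus_nat.diff_0 xs_def)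
    fix i assume i: "i < l"
    have "q i < l" using i permutes_in_image[OF q(1), of i] by (simp add: xs_def)
    moreover have "lam ! i = xs ! q i"
      using permute_list_nth[OF q(1)] i q(2) by (simp add: xs_def)
    ultimately show "int (lam ! i) = a (q i)" using nonneg by (simp add: xs_def)
  qed
qed

text \<open>\<open>Sum_any\<close> defaults to 0 on infinite support, so merging nested sums needs a
  finite set \<open>X\<close> of relevant pairs, and moving \<open>c a\<close> inside needs finite
  inner supports.\<close>

lemma Sum_any_finite_pairs:
  fixes g :: "'a \<Rightarrow> 'b \<Rightarrow> 'c::semiring_0"
  assumes "finite X" "{(a, b). c a * g a b \<noteq> 0} \<subseteq> X" "\<And>a. c a \<noteq> 0 \<Longrightarrow> finite {b. g a b \<noteq> 0}"
  shows "Sum_any (\<lambda>a. c a * Sum_any (g a)) = (\<Sum>(a, b)\<in>X. c a * g a b)"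
proof -
  have "Sum_any (\<lambda>a. c a * Sum_any (g a)) = Sum_any (\<lambda>a. Sum_any (\<lambda>b. c a * g a b))"
  proof (rule Sum_any.cong)
    fix a
    show "c a * Sum_any (g a) = Sum_any (\<lambda>b. c a * g a b)"
      using assms(3)[of a] by (cases "c a = 0") (simp_all add: Sum_any_right_distrib)
  qed
  also have "\<dots> = Sum_any (\<lambda>(a, b). c a * g a b)"
  proof (rule Sum_any.cartesian_product[OF _ order_refl])
    have "{a. \<exists>b. c a * g a b \<noteq> 0} \<subseteq> fst ` X" "{b. \<exists>a. c a * g a b \<noteq> 0} \<subseteq> snd ` X"
      using assms(2) by force+
    then show "finite ({a. \<exists>b. c a * g a b \<noteq> 0} \<times> {b. \<exists>a. c a * g a b \<noteq> 0})"
      using assms(1) by (meson finite_SigmaI finite_imageI finite_subset)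
  qed
  also have "\<dots> = (\<Sum>(a, b)\<in>X. c a * g a b)"
    using assms by (intro Sum_any.expand_superset) auto
  finally show ?thesis .
qed

lemma partition_seq_sort:
  assumes lam: "strict_partition lam" and l: "length lam = l"
    and q: "q permutes {..<l}"
    and mu: "length mu = l" "\<And>i. i < l \<Longrightarrow> int (mu ! i) = a (q i)"
    and a: "\<And>i. i \<ge> l \<Longrightarrow> a i = partition_seq lam i"
  shows "partition_seq mu = a \<circ> q"
proof
  fix i
  show "partition_seq mu i = (a \<circ> q) i"
  proof (cases "i < l")
    case False
    then have "q i = i" using permutes_not_in[OF q] by simp
    then show ?thesis using False a[of i] mu(1) l by (simp add: partition_seq_def)
  qed (use mu in \<open>simp add: partition_seq_nth\<close>)
qed

text \<open>The basis vector \<open>n\<close> occurs in \<open>J (- k)\<close> of a basis vector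
  \<open>m\<close> exactly when \<open>m\<close> is the sorted form of \<open>n\<close> with one
  entry lowered by \<open>k\<close>. Sorting produces a sign in the wedge and the same sign in the
  alternating function \<open>F\<close>; they cancel, so the unsorted sequence may be inserted into
  \<open>F\<close> directly.\<close>

lemma J_partition_seq:
  fixes F :: "(nat \<Rightarrow> int) \<Rightarrow> complex" and k :: int
  assumes lam: "strict_partition lam" "length lam = l" and k: "k \<ge> 1"
    and v0: "\<And>m. m \<notin> wedge_basis \<Longrightarrow> v m = 0"
    and vF: "\<And>mu. strict_partition mu \<Longrightarrow> length mu = l \<Longrightarrow> v (partition_seq mu) = F (partition_seq mu)"
    and alt: "\<And>a q. q permutes {..<l} \<Longrightarrow> F (a \<circ> q) = of_int (sign q) * F a"
    and neg: "\<And>a i. i < l \<Longrightarrow> a i < 0 \<Longrightarrow> F a = 0"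
  shows "J (- k) v (partition_seq lam) = (\<Sum>i<l. F ((partition_seq lam)(i := partition_seq lam i - k)))"
proof -
  define n where "n = partition_seq lam"
  define a where "a i = n(i := n i - k)" for i
  \<comment> \<open>The positions whose lowering gives distinct nonnegative leading entries, hence a
    partition of the same length after sorting. For all other \<open>i < l\<close> the value of
    \<open>F\<close> vanishes, by \<open>neg\<close> or by a repeated entry.\<close>
  define I where "I = {i. i < l \<and> inj_on (a i) {..<l} \<and> n i - k \<ge> 0}"
  have n: "n \<in> wedge_basis" using partition_seq_basis lam n_def by blast
  have injn: "inj n" using decr_seq_inj[OF wedge_basis_decr[OF n]] .
  have nn: "n i \<ge> 0 \<longleftrightarrow> i < l" for i using partition_seq_nonneg_iff lam n_def by auto
  have F_zero: "F (a i) = 0" if "i < l" "i \<notin> I" for i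
  proof (cases "n i - k \<ge> 0")
    case False
    then show ?thesis using neg[of i "a i"] that by (simp add: a_def)
  next
    case True
    then have "\<not> inj_on (a i) {..<l}" using that by (simp add: I_def)
    then obtain j j' where j: "j < l" "j' < l" "j \<noteq> j'" "a i j = a i j'" by (auto simp: inj_on_def)
    then have "a i \<circ> transpose j j' = a i" by (auto simp: fun_eq_iff transpose_def)
    then have "F (a i) = - F (a i)"
      using alt[OF permutes_swap_id, of j j' "a i"] j by (simp add: sign_swap_id)
    then show ?thesis by simp
  qed
  have "\<exists>q mu. q permutes {..<l} \<and> strict_partition mu \<and> length mu = l \<and> partition_seq mu = a i \<circ> q"
    if "i \<in> I" for i
  proof -
    have inj_a: "inj_on (a i) {..<l}" using that by (simp add: I_def)
    have nonneg: "a i j \<ge> 0" if "j < l" for j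
      using that \<open>i \<in> I\<close> nn by (auto simp: a_def I_def)
    obtain q mu where "q permutes {..<l}" "strict_partition mu" "length mu = l"
        "\<And>j. j < l \<Longrightarrow> int (mu ! j) = a i (q j)"
      using sort_decr[OF inj_a nonneg] by blast
    moreover from this have "partition_seq mu = a i \<circ> q"
      using that by (intro partition_seq_sort[OF lam]) (auto simp: I_def a_def n_def)
    ultimately show ?thesis by blast
  qed
  then obtain q mu where qmu: "\<And>i. i \<in> I \<Longrightarrow> q i permutes {..<l}" "\<And>i. i \<in> I \<Longrightarrow> strict_partition (mu i)"
      "\<And>i. i \<in> I \<Longrightarrow> length (mu i) = l" "\<And>i. i \<in> I \<Longrightarrow> partition_seq (mu i) = a i \<circ> q i"
    by metis
  \<comment> \<open>The source basis vector and the position in it that must be raised by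
    \<open>k\<close>: \<open>inv (q i) i\<close> is where sorting has put the lowered entry.\<close>
  define g where "g i = (partition_seq (mu i), inv (q i) i)" for i
  define W where "W m j = wedge (m(j := m j + k)) n" for m j
  have g_upd: "(partition_seq (mu i))(inv (q i) i := partition_seq (mu i) (inv (q i) i) + k) = n \<circ> q i"
    if "i \<in> I" for i
  proof
    fix r
    show "((partition_seq (mu i))(inv (q i) i := partition_seq (mu i) (inv (q i) i) + k)) r =
        (n \<circ> q i) r"
    proof (cases "r = inv (q i) i")
      case True
      then show ?thesis
        using permutes_inverses(1)[OF qmu(1)[OF that]] by (simp add: qmu(4)[OF that] a_def)
    next
      case False
      then have "q i r \<noteq> i" using permutes_inv_eq[OF qmu(1)[OF that]] by metis
      then show ?thesis using False by (simp add: qmu(4)[OF that] a_def)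
    qed
  qed
  have W_g: "W (partition_seq (mu i)) (inv (q i) i) = of_int (sign (q i))" if "i \<in> I" for i
    unfolding W_def g_upd[OF that]
    using wedge_permute[OF n permutes_imp_permutation[OF _ qmu(1)[OF that]]] by simp
  have inj_g: "inj_on g I"
  proof
    fix i j assume ij: "i \<in> I" "j \<in> I" "g i = g j"
    then have "n \<circ> q i = n \<circ> q j" using g_upd[OF ij(1)] g_upd[OF ij(2)] by (simp add: g_def)
    then have "q i = q j" using injn by (simp add: fun_eq_iff inj_eq)
    then show "i = j" using ij permutes_inv_eq[OF qmu(1)] by (metis g_def prod.inject)
  qed
  \<comment> \<open>Conversely, every pair contributing to \<open>n\<close> arises from some
    \<open>i \<in> I\<close>; this also supplies the finiteness that \<open>Sum_any\<close>
    requires.\<close>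
  have W_image: "(m, j) \<in> g ` I" if m: "m \<in> wedge_basis" and W: "W m j \<noteq> 0" for m j
  proof -
    obtain p where p: "permutation p" "m(j := m j + k) = n \<circ> p"
      using W unfolding W_def by (elim wedge_nonzeroE)
    have bp: "bij p" using permutation_bijective[OF p(1)] .
    define i where "i = p j"
    have mj: "m j = n i - k" using fun_cong[OF p(2), of j] by (simp add: i_def)
    have ma: "m = a i \<circ> p"
    proof
      fix r show "m r = (a i \<circ> p) r"
        using fun_cong[OF p(2), of r] mj bij_is_inj[OF bp]
        by (auto simp: a_def i_def inj_eq)
    qed
    have inj_a: "inj (a i)"
    proof -
      have "inj m" using decr_seq_inj[OF wedge_basis_decr[OF m]] .
      moreover have "a i = m \<circ> inv p"
        using bp by (simp add: ma comp_assoc surj_iff[THEN iffD1, OF bij_is_surj])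
      ultimately show ?thesis using bp by (simp add: inj_compose bij_imp_bij_inv bij_is_inj)
    qed
    have ge: "n i - k \<ge> 0"
    proof (rule ccontr)
      assume neg: "\<not> n i - k \<ge> 0"
      \<comment> \<open>The tail of \<open>n\<close> contains every negative integer, so a lowered
        entry that is negative collides with the entry at \<open>r\<close>. This excludes lowering
        any factor of the vacuum tail as well.\<close>
      define r where "r = l + nat (- (n i - k) - 1)"
      have "n r = n i - k" using neg lam by (simp add: n_def partition_seq_def r_def)
      moreover from this have "r \<noteq> i" using k by auto
      ultimately have "a i r = a i i" by (simp add: a_def)
      then show False using inj_a \<open>r \<noteq> i\<close> by (simp add: inj_eq)
    qed
    then have iI: "i \<in> I" using inj_a nn[of i] k by (auto simp: I_def intro: inj_on_subset)
    have qi: "q i permutes {..<l}" using qmu(1)[OF iI] .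
    have "m = partition_seq (mu i) \<circ> (inv (q i) \<circ> p)"
      unfolding ma qmu(4)[OF iI] using permutes_inverses[OF qi] by (simp add: fun_eq_iff)
    then have "inv (q i) \<circ> p = id"
      using decr_seq_perm_unique[OF wedge_basis_decr[OF m] partition_seq_decr[OF qmu(2)[OF iI]]]
        bij_comp[OF bp bij_imp_bij_inv[OF permutes_bij[OF qi]]] by blast
    then have "p = q i" using permutes_inverses[OF qi] by (metis comp_apply fun_eq_iff id_apply)
    then have "m = partition_seq (mu i)" "j = inv (q i) i"
      using ma qmu(4)[OF iI] permutes_inverses[OF qi] by (auto simp: i_def)
    then show ?thesis using iI by (auto simp: g_def)
  qed
  have "J (- k) v n = Sum_any (\<lambda>m. v m * Sum_any (W m))"
    by (simp add: J_def W_def)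
  also have "\<dots> = (\<Sum>(m, j)\<in>g ` I. v m * W m j)"
  proof (rule Sum_any_finite_pairs)
    show "finite (g ` I)" by (simp add: I_def)
    show "{(m, j). v m * W m j \<noteq> 0} \<subseteq> g ` I" using W_image v0 by force
    fix m assume "v m \<noteq> 0"
    then have "m \<in> wedge_basis" using v0 by blast
    have "{j. W m j \<noteq> 0} \<subseteq> snd ` (g ` I)"
    proof
      fix j assume "j \<in> {j. W m j \<noteq> 0}"
      then have "(m, j) \<in> g ` I" using W_image \<open>m \<in> wedge_basis\<close> by blast
      then show "j \<in> snd ` (g ` I)" by (metis image_eqI snd_conv)
    qed
    then show "finite {j. W m j \<noteq> 0}" by (rule finite_subset) (simp add: I_def)
  qed
  also have "\<dots> = (\<Sum>i\<in>I. v (partition_seq (mu i)) * W (partition_seq (mu i)) (inv (q i) i))"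
    by (subst sum.reindex[OF inj_g]) (simp add: g_def)
  also have "\<dots> = (\<Sum>i\<in>I. F (a i))"
  proof (rule sum.cong[OF refl])
    fix i assume i: "i \<in> I"
    have "v (partition_seq (mu i)) = of_int (sign (q i)) * F (a i)"
      using vF[OF qmu(2,3)[OF i]] alt[OF qmu(1)[OF i]] qmu(4)[OF i] by simp
    moreover have "of_int (sign (q i)) * (of_int (sign (q i)) :: complex) = 1"
      by (metis of_int_1 of_int_mult sign_idempotent)
    ultimately show "v (partition_seq (mu i)) * W (partition_seq (mu i)) (inv (q i) i) = F (a i)"
      by (simp add: W_g[OF i])
  qed
  also have "\<dots> = (\<Sum>i<l. F (a i))"
    by (rule sum.mono_neutral_left) (use F_zero in \<open>auto simp: I_def\<close>)
  finally show ?thesis by (simp add: n_def a_def)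
qed

lemma J_outside: "n \<notin> wedge_basis \<Longrightarrow> J k v n = 0"
  by (simp add: J_def wedge_def)

lemma H_minus_outside:
  assumes "n \<notin> wedge_basis"
  shows "H_minus s N v n = 0"
proof -
  have "H_minus s N v n = Sum_any (\<lambda>k::nat. 0)"
    unfolding H_minus_def by (rule Sum_any.cong) (auto simp: J_outside[OF assms])
  then show ?thesis by simp
qed

section \<open>Matrix coefficients of the half vertex operator\<close>

text \<open>The constant term is set to 0 so that composing the exponential series with it is
  meaningful.\<close>

definition power_sums :: "(nat \<Rightarrow> nat \<Rightarrow> complex) \<Rightarrow> nat \<Rightarrow> complex fps" where
  "power_sums s N = Abs_fps (\<lambda>k. if k = 0 then 0 else \<Sum>j=1..N. s k j)"

text \<open>The coefficient of \<open>X\<^sup>k\<close> in \<open>exp (z P)\<close>, as a polynomial in the auxiliary variable z: the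
  coefficient of \<open>z\<^sup>p\<close> tracks the p-th power of \<open>H_-\<close>, and one more application of \<open>H_-\<close> is
  differentiation in z.\<close>

definition exp_poly :: "complex fps \<Rightarrow> int \<Rightarrow> complex poly" where
  "exp_poly P k = (if k < 0 then 0 else \<Sum>p\<le>nat k. monom (fps_nth (P ^ p) (nat k) / fact p) p)"

text \<open>Truncating at \<open>p \<le> k\<close> loses nothing: \<open>P\<close> has no constant
  term, so \<open>P ^ p\<close> starts in degree at least \<open>p\<close>.\<close>

lemma coeff_exp_poly:
  assumes "fps_nth P 0 = 0"
  shows "coeff (exp_poly P k) p = (if k < 0 then 0 else fps_nth (P ^ p) (nat k) / fact p)"
  using startsby_zero_power_prefix[OF assms, of p] by (auto simp: exp_poly_def coeff_sum)

lemma poly_exp_poly: "poly (exp_poly P k) 1 = int_coeff (fps_exp 1 oo P) k"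
  by (auto simp: exp_poly_def int_coeff_def poly_sum poly_monom fps_compose_nth
      atLeast0AtMost intro!: sum.cong)

text \<open>This is \<open>d/dz exp (z P) = P exp (z P)\<close> read off coefficientwise. Any bound
  \<open>K \<ge> k\<close> is allowed, so that all entries of a determinant share one summation
  range.\<close>

lemma pderiv_exp_poly:
  assumes P: "fps_nth P 0 = 0" and K: "k \<le> int K"
  shows "pderiv (exp_poly P k) = (\<Sum>l=1..K. [:fps_nth P l:] * exp_poly P (k - int l))"
proof (rule poly_eqI)
  fix p
  show "coeff (pderiv (exp_poly P k)) p = coeff (\<Sum>l=1..K. [:fps_nth P l:] * exp_poly P (k - int l)) p"
  proof (cases "k < 0")
    case True
    then show ?thesis by (simp add: coeff_pderiv coeff_sum coeff_exp_poly[OF P])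
  next
    case False
    define n where "n = nat k"
    have k: "k = int n" using False by (simp add: n_def)
    have "coeff (pderiv (exp_poly P k)) p = fps_nth (P * P ^ p) n / fact p"
      using False by (simp add: coeff_pderiv coeff_exp_poly[OF P] k field_simps del: of_nat_Suc)
    also have "\<dots> = (\<Sum>l=0..n. fps_nth P l * (fps_nth (P ^ p) (n - l) / fact p))"
      by (simp add: fps_mult_nth sum_divide_distrib)
    also have "\<dots> = (\<Sum>l=1..n. fps_nth P l * (fps_nth (P ^ p) (n - l) / fact p))"
      using P by (intro sum.mono_neutral_right) (auto simp: Suc_le_eq)
    also have "\<dots> = (\<Sum>l=1..K. if l \<le> n then fps_nth P l * (fps_nth (P ^ p) (n - l) / fact p) else 0)"
      using K k by (intro sum.mono_neutral_cong_left) auto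
    also have "\<dots> = coeff (\<Sum>l=1..K. [:fps_nth P l:] * exp_poly P (k - int l)) p"
      unfolding coeff_sum
      by (intro sum.cong refl) (auto simp: coeff_exp_poly[OF P] k nat_diff_distrib)
    finally show ?thesis .
  qed
qed

text \<open>The argument \<open>a\<close> is an arbitrary integer sequence, so the determinant can
  be evaluated at lowered, unsorted sequences as \<open>J_partition_seq\<close> requires. Different
  lengths mean different charges, hence the value 0.\<close>

definition fock_det :: "complex fps \<Rightarrow> nat list \<Rightarrow> nat \<Rightarrow> (nat \<Rightarrow> int) \<Rightarrow> complex poly" where
  "fock_det P mu l a = (if l = length mu
     then leibniz_det l (\<lambda>i j. exp_poly P (a i - int (mu ! j))) else 0)"

lemma fock_det_permute:
  assumes "q permutes {..<l}"
  shows "fock_det P mu l (a \<circ> q) = of_int (sign q) * fock_det P mu l a"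
proof (cases "l = length mu")
  case True
  show ?thesis
    using leibniz_det_permute[OF assms, of "\<lambda>i j. exp_poly P (a i - int (mu ! j))"]
    unfolding fock_det_def if_P[OF True] by simp
qed (simp add: fock_det_def)

lemma fock_det_neg: "i < l \<Longrightarrow> a i < 0 \<Longrightarrow> fock_det P mu l a = 0"
  by (auto simp: fock_det_def exp_poly_def intro!: leibniz_det_zero_row[of i])

text \<open>Differentiating row \<open>i\<close> shifts its index by \<open>k\<close> with weight
  \<open>fps_nth P k\<close>, which is the action of \<open>H_minus\<close> on the factor
  \<open>i\<close>.\<close>

lemma pderiv_fock_det:
  assumes P: "fps_nth P 0 = 0" and K: "\<And>i. i < l \<Longrightarrow> a i \<le> int K"
  shows "pderiv (fock_det P mu l a) =
    (\<Sum>k=1..K. [:fps_nth P k:] * (\<Sum>i<l. fock_det P mu l (a(i := a i - int k))))"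
proof (cases "l = length mu")
  case True
  define f where "f = (\<lambda>i j. exp_poly P (a i - int (mu ! j)))"
  have "pderiv (fock_det P mu l a) = (\<Sum>i<l. leibniz_det l (f(i := \<lambda>j. pderiv (f i j))))"
    using True by (simp add: fock_det_def pderiv_leibniz_det f_def)
  also have "\<dots> = (\<Sum>i<l. \<Sum>k=1..K. [:fps_nth P k:] * fock_det P mu l (a(i := a i - int k)))"
  proof (rule sum.cong[OF refl])
    fix i assume i: "i \<in> {..<l}"
    have "pderiv (f i j) = (\<Sum>k=1..K. [:fps_nth P k:] * exp_poly P (a i - int k - int (mu ! j)))" for j
    proof -
      have "a i - int (mu ! j) \<le> int K" using K[of i] i by simp
      then show ?thesis unfolding f_def using pderiv_exp_poly[OF P] by (simp add: algebra_simps)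
    qed
    then have "leibniz_det l (f(i := \<lambda>j. pderiv (f i j))) =
        leibniz_det l (f(i := \<lambda>j. \<Sum>k=1..K. [:fps_nth P k:] * exp_poly P (a i - int k - int (mu ! j))))"
      by presburger
    also have "\<dots> = (\<Sum>k=1..K. [:fps_nth P k:] *
        leibniz_det l (f(i := \<lambda>j. exp_poly P (a i - int k - int (mu ! j)))))"
      using i by (intro leibniz_det_sum_row) simp
    also have "\<dots> = (\<Sum>k=1..K. [:fps_nth P k:] * fock_det P mu l (a(i := a i - int k)))"
      unfolding fock_det_def f_def if_P[OF True]
      by (intro sum.cong refl arg_cong2[where f = "(*)"] leibniz_det_cong) auto
    finally show "leibniz_det l (f(i := \<lambda>j. pderiv (f i j))) =
        (\<Sum>k=1..K. [:fps_nth P k:] * fock_det P mu l (a(i := a i - int k)))" .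
  qed
  also have "\<dots> = (\<Sum>k=1..K. [:fps_nth P k:] * (\<Sum>i<l. fock_det P mu l (a(i := a i - int k))))"
    unfolding sum_distrib_left by (rule sum.swap)
  finally show ?thesis .
qed (simp add: fock_det_def)

text \<open>Lowering any part by more than \<open>K\<close> makes it negative, so the infinite sum
  over modes stops at \<open>K\<close>.\<close>

lemma H_minus_partition_seq:
  assumes lam: "strict_partition lam" "length lam = l" "\<And>i. i < l \<Longrightarrow> lam ! i \<le> K"
    and v0: "\<And>m. m \<notin> wedge_basis \<Longrightarrow> v m = 0"
    and vF: "\<And>mu. strict_partition mu \<Longrightarrow> length mu = l \<Longrightarrow> v (partition_seq mu) = F (partition_seq mu)"
    and alt: "\<And>a q. q permutes {..<l} \<Longrightarrow> F (a \<circ> q) = of_int (sign q) * F a"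
    and neg: "\<And>a i. i < l \<Longrightarrow> a i < 0 \<Longrightarrow> F a = 0"
  shows "H_minus s N v (partition_seq lam) = (\<Sum>k=1..K. fps_nth (power_sums s N) k *
    (\<Sum>i<l. F ((partition_seq lam)(i := partition_seq lam i - int k))))"
proof -
  define T where "T k = (\<Sum>i<l. F ((partition_seq lam)(i := partition_seq lam i - int k)))" for k
  have J: "J (- int k) v (partition_seq lam) = T k" if "k \<ge> 1" for k
    unfolding T_def
  proof (rule J_partition_seq[OF lam(1,2)])
    show "1 \<le> int k" using that by simp
  qed (rule v0 vF alt neg; assumption)+
  have T0: "T k = 0" if "k > K" for k
    unfolding T_def
  proof (rule sum.neutral, rule)
    fix i assume "i \<in> {..<l}"
    then show "F ((partition_seq lam)(i := partition_seq lam i - int k)) = 0"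
      using lam(2) lam(3)[of i] that by (intro neg[of i]) (auto simp: partition_seq_nth)
  qed
  have "H_minus s N v (partition_seq lam) = Sum_any (\<lambda>k. fps_nth (power_sums s N) k * T k)"
    unfolding H_minus_def
    by (rule Sum_any.cong) (auto simp: J power_sums_def sum_distrib_right)
  also have "\<dots> = (\<Sum>k=1..K. fps_nth (power_sums s N) k * T k)"
  proof (rule Sum_any.expand_superset)
    have "k \<in> {1..K}" if "fps_nth (power_sums s N) k * T k \<noteq> 0" for k
      using that T0[of k] by (cases "k = 0"; cases "k \<le> K") (auto simp: power_sums_def)
    then show "{k. fps_nth (power_sums s N) k * T k \<noteq> 0} \<subseteq> {1..K}" by blast
  qed simp
  finally show ?thesis by (simp add: T_def)
qed

text \<open>Induction on \<open>p\<close>: at \<open>z = 0\<close> the determinant is a Kronecker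
  delta, and each further \<open>H_minus\<close> is one differentiation in \<open>z\<close>, which
  accounts for the factorial.\<close>

lemma H_minus_power_partition_seq:
  assumes "strict_partition mu" "strict_partition lam" "length lam = l"
  shows "(H_minus s N ^^ p) (ket mu) (partition_seq lam) =
    fact p * coeff (fock_det (power_sums s N) mu l (partition_seq lam)) p"
  using assms(2,3)
proof (induction p arbitrary: lam)
  case 0
  have P: "fps_nth (power_sums s N) 0 = 0" by (simp add: power_sums_def)
  have "coeff (fock_det (power_sums s N) mu l (partition_seq lam)) 0 = (if lam = mu then 1 else 0)"
  proof (cases "l = length mu")
    case True
    have "coeff (fock_det (power_sums s N) mu l (partition_seq lam)) 0 =
        leibniz_det l (\<lambda>i j. if lam ! i = mu ! j then 1 else 0)"
      unfolding fock_det_def if_P[OF True] poly_0_coeff_0[symmetric] poly_leibniz_det using 0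
      by (intro leibniz_det_cong) (auto simp: poly_0_coeff_0 coeff_exp_poly[OF P] partition_seq_nth)
    then show ?thesis
      using leibniz_det_delta[OF "0.prems"(1) assms(1) "0.prems"(2) True[symmetric]] by simp
  qed (use 0 in \<open>auto simp: fock_det_def\<close>)
  then show ?case using 0 assms(1) by (simp add: ket_partition_seq)
next
  case (Suc p)
  define P where "P = power_sums s N"
  define F where "F a = fact p * coeff (fock_det P mu l a) p" for a
  \<comment> \<open>Inserting 0 keeps \<open>Max\<close> meaningful for the empty partition.\<close>
  define K where "K = Max (insert 0 (set lam))"
  have K: "lam ! i \<le> K" if "i < l" for i
    unfolding K_def using that Suc.prems by (intro Max_ge) auto
  have "(H_minus s N ^^ Suc p) (ket mu) (partition_seq lam) =
      H_minus s N ((H_minus s N ^^ p) (ket mu)) (partition_seq lam)" by simp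
  also have "\<dots> = (\<Sum>k=1..K. fps_nth (power_sums s N) k *
      (\<Sum>i<l. F ((partition_seq lam)(i := partition_seq lam i - int k))))"
  proof (rule H_minus_partition_seq[OF Suc.prems K])
    show "(H_minus s N ^^ p) (ket mu) m = 0" if "m \<notin> wedge_basis" for m
      using that by (cases p) (auto simp: ket_outside H_minus_outside)
    show "(H_minus s N ^^ p) (ket mu) (partition_seq nu) = F (partition_seq nu)"
      if "strict_partition nu" "length nu = l" for nu
      using Suc.IH[OF that] by (simp add: F_def P_def)
    show "F (a \<circ> q) = of_int (sign q) * F a" if "q permutes {..<l}" for a q
      unfolding F_def fock_det_permute[OF that] by (cases q rule: sign_cases) simp_all
    show "F a = 0" if "i < l" "a i < 0" for a i
      using that by (simp add: F_def fock_det_neg)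
  qed
  also have "\<dots> = fact p * coeff (pderiv (fock_det P mu l (partition_seq lam))) p"
    by (subst pderiv_fock_det[where K = K])
      (use K Suc.prems in \<open>auto simp: P_def power_sums_def F_def coeff_sum sum_distrib_left
        partition_seq_nth ac_simps\<close>)
  also have "\<dots> = fact (Suc p) * coeff (fock_det P mu l (partition_seq lam)) (Suc p)"
    by (simp add: coeff_pderiv algebra_simps)
  finally show ?case by (simp add: P_def)
qed

text \<open>The factorials cancel, so the exponential series adds up the coefficients of a
  polynomial in \<open>z\<close>, that is, evaluates it at 1. The result is a determinant of
  Jacobi-Trudi type.\<close>

lemma bracket_exp_H_minus:
  assumes "strict_partition lam" "strict_partition mu"
  shows "bracket lam (exp_H_minus s N) mu = (if length lam = length mu
    then leibniz_det (length lam)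
      (\<lambda>i j. int_coeff (fps_exp 1 oo power_sums s N) (int (lam ! i) - int (mu ! j)))
    else 0)"
proof -
  define Q where "Q = fock_det (power_sums s N) mu (length lam) (partition_seq lam)"
  have "bracket lam (exp_H_minus s N) mu = Sum_any (\<lambda>p. coeff Q p)"
    unfolding bracket_def exp_H_minus_def Q_def
    by (rule Sum_any.cong) (simp add: H_minus_power_partition_seq[OF assms(2,1) refl])
  also have "\<dots> = (\<Sum>p\<le>degree Q. coeff Q p)"
    by (rule Sum_any.expand_superset) (auto intro: le_degree)
  also have "\<dots> = poly Q 1" by (simp add: poly_altdef)
  also have "\<dots> = (if length lam = length mu then leibniz_det (length lam)
      (\<lambda>i j. int_coeff (fps_exp 1 oo power_sums s N) (int (lam ! i) - int (mu ! j))) else 0)"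
    unfolding Q_def fock_det_def
    by (auto simp: poly_leibniz_det poly_exp_poly partition_seq_nth intro!: leibniz_det_cong)
  finally show ?thesis .
qed

section \<open>Row transfer in the six-vertex model\<close>

lemma sum_PiE_insert:
  assumes "a \<notin> A"
  shows "(\<Sum>f\<in>Pi\<^sub>E (insert a A) B. g f) = (\<Sum>y\<in>B a. \<Sum>f\<in>Pi\<^sub>E A B. g (f(a := y)))"
proof -
  have "(\<Sum>f\<in>Pi\<^sub>E (insert a A) B. g f) = (\<Sum>(y, f)\<in>B a \<times> Pi\<^sub>E A B. g (f(a := y)))"
    unfolding PiE_insert_eq by (subst sum.reindex[OF inj_combinator[OF assms]]) (simp add: case_prod_unfold)
  then show ?thesis by (simp add: sum.cartesian_product)
qed

lemma UNIV_spin: "UNIV = {Plus, Minus}"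
  by (auto intro: spin.exhaust)

lemma finite_UNIV_spin [simp]: "finite (UNIV :: spin set)"
  by (simp add: UNIV_spin)

lemma sum_spin: "(\<Sum>s\<in>UNIV. f s) = f Plus + f Minus"
  by (simp add: UNIV_spin)

text \<open>The sum over the first m columns of a row with the spin s on the edge leaving them.\<close>

primrec row_partial ::
  "row_weights \<Rightarrow> (nat \<Rightarrow> spin) \<Rightarrow> (nat \<Rightarrow> spin) \<Rightarrow> nat \<Rightarrow> spin \<Rightarrow> complex" where
  "row_partial w t b 0 s = (if s = Plus then 1 else 0)"
| "row_partial w t b (Suc m) s' =
    (\<Sum>s\<in>UNIV. row_partial w t b m s * vertex_weight w s (t m) s' (b m))"

lemma row_partial_cong:
  assumes "\<And>j. j < m \<Longrightarrow> t j = t' j" "\<And>j. j < m \<Longrightarrow> b j = b' j"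
  shows "row_partial w t b m s = row_partial w t' b' m s"
  using assms by (induction m arbitrary: s) auto

text \<open>Spins of the \<open>m + 1\<close> horizontal edges of a row with the left boundary
  fixed; the last edge stays free so that columns can be appended.\<close>

definition row_states :: "nat \<Rightarrow> (nat \<Rightarrow> spin) set" where
  "row_states m = (\<Pi>\<^sub>E j\<in>{..m}. if j = 0 then {Plus} else UNIV)"

lemma finite_row_states [simp]: "finite (row_states m)"
  by (auto simp: row_states_def intro: finite_PiE)

text \<open>The weight \<open>f\<close> on the last edge makes the induction work: the vertex of the
  new column is absorbed into \<open>f\<close>.\<close>

lemma row_states_sum:
  "(\<Sum>g\<in>row_states m. (\<Prod>j<m. vertex_weight w (g j) (t j) (g (Suc j)) (b j)) * f (g m)) =
    (\<Sum>s\<in>UNIV. row_partial w t b m s * f s)"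
proof (induction m arbitrary: f)
  case 0
  have "{..0::nat} = insert 0 {}" by auto
  then show ?case
    by (simp add: row_states_def sum_PiE_insert sum_spin del: atMost_0)
next
  case (Suc m)
  have "(\<Sum>g\<in>row_states (Suc m). (\<Prod>j<Suc m. vertex_weight w (g j) (t j) (g (Suc j)) (b j)) * f (g (Suc m))) =
      (\<Sum>s'\<in>UNIV. \<Sum>g\<in>row_states m.
        (\<Prod>j<m. vertex_weight w (g j) (t j) (g (Suc j)) (b j)) * (vertex_weight w (g m) (t m) s' (b m) * f s'))"
    unfolding row_states_def atMost_Suc by (simp add: sum_PiE_insert ac_simps)
  also have "\<dots> = (\<Sum>s'\<in>UNIV. \<Sum>s\<in>UNIV. row_partial w t b m s * (vertex_weight w s (t m) s' (b m) * f s'))"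
    by (intro sum.cong refl) (rule Suc.IH)
  also have "\<dots> = (\<Sum>s'\<in>UNIV. row_partial w t b (Suc m) s' * f s')"
    by (simp add: sum_distrib_right mult.assoc)
  finally show ?case .
qed

lemma row_sum:
  "(\<Sum>g | g \<in> row_states m \<and> g m = Plus. \<Prod>j<m. vertex_weight w (g j) (t j) (g (Suc j)) (b j)) =
    row_partial w t b m Plus"
proof -
  have "(\<Sum>g | g \<in> row_states m \<and> g m = Plus. \<Prod>j<m. vertex_weight w (g j) (t j) (g (Suc j)) (b j)) =
      (\<Sum>g\<in>row_states m. (\<Prod>j<m. vertex_weight w (g j) (t j) (g (Suc j)) (b j)) *
        (if g m = Plus then 1 else 0))"
    by (auto simp: sum.inter_filter intro!: sum.cong)
  also have "\<dots> = row_partial w t b m Plus"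
    using row_states_sum[where f = "\<lambda>s. if s = Plus then 1 else 0"] by (simp add: sum_spin)
  finally show ?thesis .
qed

section \<open>Stacking rows into a grid\<close>

primrec transfer ::
  "(nat \<Rightarrow> row_weights) \<Rightarrow> nat \<Rightarrow> (nat \<Rightarrow> spin) \<Rightarrow> nat \<Rightarrow> (nat \<Rightarrow> spin) \<Rightarrow> complex" where
  "transfer W M t 0 b = (if \<forall>j\<le>M. t j = b j then 1 else 0)"
| "transfer W M t (Suc N) b = (\<Sum>u\<in>{..M} \<rightarrow>\<^sub>E UNIV.
    transfer W M t N u * row_partial (W (Suc N)) u b (Suc M) Plus)"

text \<open>Arbitrary top and bottom spins are allowed, because the spins between two rows become a
  boundary when the grid is cut.\<close>

definition grid_states ::
  "nat \<Rightarrow> nat \<Rightarrow> (nat \<Rightarrow> spin) \<Rightarrow> (nat \<Rightarrow> spin) \<Rightarrow> ((nat \<times> nat \<Rightarrow> spin) \<times> (nat \<times> nat \<Rightarrow> spin)) set" where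
  "grid_states N M t b = {(h, v).
     h \<in> ({1..N} \<times> {0..M + 1}) \<rightarrow>\<^sub>E UNIV \<and>
     v \<in> ({0..N} \<times> {0..M}) \<rightarrow>\<^sub>E UNIV \<and>
     (\<forall>i\<in>{1..N}. h (i, 0) = Plus \<and> h (i, M + 1) = Plus) \<and>
     (\<forall>j\<in>{0..M}. v (0, j) = t j \<and> v (N, j) = b j)}"

definition grid_weight ::
  "(nat \<Rightarrow> row_weights) \<Rightarrow> nat \<Rightarrow> nat \<Rightarrow> (nat \<times> nat \<Rightarrow> spin) \<times> (nat \<times> nat \<Rightarrow> spin) \<Rightarrow> complex" where
  "grid_weight W N M = (\<lambda>(h, v). \<Prod>i=1..N. \<Prod>j=0..M.
     vertex_weight (W i) (h (i, j)) (v (i - 1, j)) (h (i, j + 1)) (v (i, j)))"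

lemma finite_grid_states: "finite (grid_states N M t b)"
proof (rule finite_subset)
  show "grid_states N M t b \<subseteq>
      (({1..N} \<times> {0..M + 1}) \<rightarrow>\<^sub>E UNIV) \<times> (({0..N} \<times> {0..M}) \<rightarrow>\<^sub>E UNIV)"
    by (auto simp: grid_states_def)
  show "finite ((({1..N} \<times> {0..M + 1}) \<rightarrow>\<^sub>E (UNIV :: spin set)) \<times> (({0..N} \<times> {0..M}) \<rightarrow>\<^sub>E (UNIV :: spin set)))"
    by (intro finite_cartesian_product finite_PiE) auto
qed

lemma grid_states_0:
  "(\<Sum>st\<in>grid_states 0 M t b. grid_weight W 0 M st) = (if \<forall>j\<le>M. t j = b j then 1 else 0)"
proof (cases "\<forall>j\<le>M. t j = b j")
  case True
  have "grid_states 0 M t b = {(\<lambda>_. undefined, restrict (\<lambda>(i, j). t j) ({0} \<times> {0..M}))}"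
    using True by (auto simp: grid_states_def fun_eq_iff PiE_iff extensional_def restrict_def)
  then show ?thesis using True by (simp add: grid_weight_def)
next
  case False
  then have "grid_states 0 M t b = {}" by (force simp: grid_states_def)
  then show ?thesis using False by simp
qed

text \<open>Cutting above the last row is a bijection from states to triples of the vertical spins
  \<open>u\<close> on the cut, a state of the upper grid with bottom \<open>u\<close>, and the
  horizontal spins of the last row.\<close>

lemma grid_states_Suc:
  "(\<Sum>st\<in>grid_states (Suc N) M t b. grid_weight W (Suc N) M st) =
    (\<Sum>u\<in>{..M} \<rightarrow>\<^sub>E UNIV. (\<Sum>st\<in>grid_states N M t u. grid_weight W N M st) *
      row_partial (W (Suc N)) u b (Suc M) Plus)"
proof -
  define R where "R = {g. g \<in> row_states (Suc M) \<and> g (Suc M) = Plus}"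
  define rw where "rw u g = (\<Prod>j<Suc M. vertex_weight (W (Suc N)) (g j) (u j) (g (Suc j)) (b j))" for u g
  define T where "T = (SIGMA u:({..M} \<rightarrow>\<^sub>E (UNIV :: spin set)). grid_states N M t u \<times> R)"
  define join :: "(nat \<Rightarrow> spin) \<times> ((nat \<times> nat \<Rightarrow> spin) \<times> (nat \<times> nat \<Rightarrow> spin)) \<times> (nat \<Rightarrow> spin) \<Rightarrow> _"
    where "join = (\<lambda>(u, (h, v), g). (\<lambda>(i, j). if i = Suc N then g j else h (i, j),
      \<lambda>(i, j). if i = Suc N \<and> j \<le> M then b j else v (i, j)))"
  define cut :: "(nat \<times> nat \<Rightarrow> spin) \<times> (nat \<times> nat \<Rightarrow> spin) \<Rightarrow> _"
    where "cut = (\<lambda>(h, v). (restrict (\<lambda>j. v (N, j)) {..M},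
      (restrict h ({1..N} \<times> {0..M + 1}), restrict v ({0..N} \<times> {0..M})),
      restrict (\<lambda>j. h (Suc N, j)) {..Suc M}))"
  have "(\<Sum>st\<in>grid_states (Suc N) M t b. grid_weight W (Suc N) M st) =
      (\<Sum>(u, st, g)\<in>T. grid_weight W N M st * rw u g)"
  proof (rule sum.reindex_bij_witness[where i = join and j = cut])
    fix st assume st: "st \<in> grid_states (Suc N) M t b"
    obtain h v where hv: "st = (h, v)" by (cases st)
    note S = st[unfolded hv grid_states_def PiE_iff extensional_def, simplified]
    show "join (cut st) = st"
      unfolding hv join_def cut_def using S by (auto simp: fun_eq_iff restrict_def)
    show "cut st \<in> T"
      unfolding hv cut_def T_def R_def row_states_def using S
      by (auto simp: grid_states_def PiE_iff extensional_def)
    have "(\<Prod>i=1..N. \<Prod>j=0..M. vertex_weight (W i)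
          (restrict h ({1..N} \<times> {0..M + 1}) (i, j)) (restrict v ({0..N} \<times> {0..M}) (i - 1, j))
          (restrict h ({1..N} \<times> {0..M + 1}) (i, j + 1)) (restrict v ({0..N} \<times> {0..M}) (i, j))) =
        (\<Prod>i=1..N. \<Prod>j=0..M. vertex_weight (W i) (h (i, j)) (v (i - 1, j)) (h (i, j + 1)) (v (i, j)))"
      by (intro prod.cong refl) auto
    moreover have "rw (restrict (\<lambda>j. v (N, j)) {..M}) (restrict (\<lambda>j. h (Suc N, j)) {..Suc M}) =
        (\<Prod>j=0..M. vertex_weight (W (Suc N)) (h (Suc N, j)) (v (N, j)) (h (Suc N, j + 1)) (v (Suc N, j)))"
      unfolding rw_def using S by (intro prod.cong) auto
    ultimately show "(case cut st of (u, st, g) \<Rightarrow> grid_weight W N M st * rw u g) =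
        grid_weight W (Suc N) M st"
      unfolding hv by (simp add: grid_weight_def cut_def)
  next
    fix x assume x: "x \<in> T"
    obtain u h v g where xx: "x = (u, (h, v), g)" by (metis prod.collapse)
    note S = x[unfolded xx T_def R_def row_states_def grid_states_def PiE_iff extensional_def, simplified]
    show "cut (join x) = x"
      unfolding xx join_def cut_def using S by (auto simp: fun_eq_iff restrict_def)
    show "join x \<in> grid_states (Suc N) M t b"
      unfolding xx join_def using S
      by (auto simp: grid_states_def PiE_iff extensional_def split: if_splits)
  qed
  also have "\<dots> = (\<Sum>u\<in>{..M} \<rightarrow>\<^sub>E UNIV. \<Sum>(st, g)\<in>grid_states N M t u \<times> R. grid_weight W N M st * rw u g)"
    unfolding T_def
    by (subst sum.Sigma) (auto intro!: finite_PiE simp: finite_grid_states R_def)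
  also have "\<dots> = (\<Sum>u\<in>{..M} \<rightarrow>\<^sub>E UNIV. (\<Sum>st\<in>grid_states N M t u. grid_weight W N M st) *
      row_partial (W (Suc N)) u b (Suc M) Plus)"
    unfolding sum.cartesian_product[symmetric] R_def row_sum[symmetric] rw_def
    by (simp add: sum_product)
  finally show ?thesis .
qed

lemma grid_states_transfer:
  "(\<Sum>st\<in>grid_states N M t b. grid_weight W N M st) = transfer W M t N b"
  by (induction N arbitrary: b) (simp_all only: grid_states_0 grid_states_Suc transfer.simps)

lemma partition_function_transfer:
  "partition_function W N M lam mu = transfer W M (part_spin lam) N (part_spin mu)"
proof -
  have "lattice_states N M lam mu = grid_states N M (part_spin lam) (part_spin mu)"
    unfolding lattice_states_def grid_states_def ..
  then show ?thesis
    unfolding partition_function_def grid_states_transfer[symmetric] grid_weight_def by simp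
qed

section \<open>The free fermionic partition function as a determinant\<close>

primrec occupied :: "nat \<Rightarrow> (nat \<Rightarrow> spin) \<Rightarrow> nat list" where
  "occupied 0 b = []"
| "occupied (Suc m) b = (if b m = Minus then [m] else []) @ occupied m b"

lemma set_occupied: "set (occupied m b) = {j. j < m \<and> b j = Minus}"
  by (induction m) (auto simp: less_Suc_eq)

lemma strict_partition_occupied: "strict_partition (occupied m b)"
  unfolding strict_partition_def by (induction m) (auto simp: set_occupied)

lemma occupied_cong: "(\<And>j. j < m \<Longrightarrow> b j = b' j) \<Longrightarrow> occupied m b = occupied m b'"
  by (induction m) auto

lemma occupied_eq_iff: "occupied m b = occupied m b' \<longleftrightarrow> (\<forall>j<m. b j = b' j)"
proof
  assume eq: "occupied m b = occupied m b'"
  show "\<forall>j<m. b j = b' j"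
  proof (intro allI impI)
    fix j assume "j < m"
    then have "b j = Minus \<longleftrightarrow> b' j = Minus"
      using set_occupied[of m b] set_occupied[of m b'] eq by auto
    then show "b j = b' j" by (cases "b j"; cases "b' j") auto
  qed
qed (auto intro: occupied_cong)

lemma strict_partition_eqI:
  assumes "strict_partition a" "strict_partition b" "set a = set b"
  shows "a = b"
proof -
  have "rev a = rev b"
    using assms by (intro strict_sorted_equal) (auto simp: strict_partition_def sorted_wrt_rev)
  then show ?thesis by simp
qed

lemma largest_part_ge:
  assumes "strict_partition lam" "p \<in> set lam"
  shows "p \<le> largest_part lam"
  using assms by (cases lam) (auto simp: strict_partition_def largest_part_def)

lemma occupied_part_spin:
  assumes "strict_partition lam" "largest_part lam \<le> M"
  shows "occupied (Suc M) (part_spin lam) = lam"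
proof (rule strict_partition_eqI[OF strict_partition_occupied assms(1)])
  have "p < Suc M" if "p \<in> set lam" for p
    using largest_part_ge[OF assms(1) that] assms(2) by simp
  then show "set (occupied (Suc M) (part_spin lam)) = set lam"
    unfolding set_occupied by (auto simp: part_spin_def)
qed

text \<open>Lists let the vectors be concatenated column by column; a wrong number of particles
  gives 0, which encodes particle conservation.\<close>

definition list_det :: "nat \<Rightarrow> (nat \<Rightarrow> complex) list \<Rightarrow> complex" where
  "list_det n vs = (if length vs = n then leibniz_det n (\<lambda>i. vs ! i) else 0)"

lemma list_det_linear:
  "list_det n (us @ (\<lambda>a. c * v a + d * w a) # ws) =
    c * list_det n (us @ v # ws) + d * list_det n (us @ w # ws)"
proof (cases "length us + Suc (length ws) = n")
  case True
  have upd: "(\<lambda>i. (us @ u # ws) ! i) = (\<lambda>i. (us @ v # ws) ! i)(length us := u)" for u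
    by (auto simp: fun_eq_iff nth_append nth_Cons split: nat.splits)
  have "length us < n" using True by simp
  from leibniz_det_linear_row[OF this, of "\<lambda>i. (us @ v # ws) ! i" c v d w] show ?thesis
    using True unfolding list_det_def
    by (simp add: upd[of "\<lambda>a. c * v a + d * w a"] upd[of w] upd[of v, symmetric])
qed (simp add: list_det_def)

lemma list_det_repeat: "list_det n (us @ v # v # ws) = 0"
  using leibniz_det_eq_rows[of "length us" n "Suc (length us)" "\<lambda>i. (us @ v # v # ws) ! i"]
  by (auto simp: list_det_def nth_append)

text \<open>Polarization: expand the vanishing determinant with \<open>v + w\<close> in both places.
  The coefficients 1 match the form of \<open>list_det_linear\<close>.\<close>

lemma list_det_swap: "list_det n (us @ v # w # ws) = - list_det n (us @ w # v # ws)"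
proof -
  define s where "s = (\<lambda>a. 1 * v a + 1 * w a)"
  have "0 = list_det n (us @ s # s # ws)" by (simp add: list_det_repeat)
  also have "\<dots> = list_det n (us @ v # s # ws) + list_det n (us @ w # s # ws)"
    using list_det_linear[of n us 1 v 1 w "s # ws"] by (simp add: s_def)
  also have "\<dots> = list_det n (us @ v # w # ws) + list_det n (us @ w # v # ws)"
    using list_det_linear[of n "us @ [v]" 1 v 1 w ws] list_det_linear[of n "us @ [w]" 1 v 1 w ws]
    by (simp add: s_def list_det_repeat)
  finally show ?thesis by (simp add: eq_neg_iff_add_eq_0)
qed

lemma list_det_zero: "list_det n (us @ (\<lambda>a. 0) # ws) = 0"
  using list_det_linear[of n us 0 v 0 v ws for v] by simp

text \<open>Particles are replaced by vectors: \<open>r m\<close> is a particle leaving the row upwards in column m,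
  \<open>carried\<close> one travelling on the horizontal edge to the left of column m, \<open>moved\<close> one entering
  from below in column m (weights normalized to \<open>A = B = 1\<close>).\<close>

definition carried :: "complex \<Rightarrow> nat \<Rightarrow> (nat \<Rightarrow> nat \<Rightarrow> complex) \<Rightarrow> nat \<Rightarrow> nat \<Rightarrow> complex" where
  "carried y M r m = (\<lambda>a. \<Sum>l=m..M. y ^ (l - m) * r l a)"

definition moved :: "complex \<Rightarrow> complex \<Rightarrow> nat \<Rightarrow> (nat \<Rightarrow> nat \<Rightarrow> complex) \<Rightarrow> nat \<Rightarrow> nat \<Rightarrow> complex" where
  "moved x y M r m = (\<lambda>a. r m a + (x + y) * carried y M r (Suc m) a)"

text \<open>A carried particle either leaves upwards in column \<open>m\<close> (weight
  \<open>c2 = 1\<close>) or travels on (weight \<open>b2 = y\<close>).\<close>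

lemma carried_rec:
  assumes "m \<le> M"
  shows "carried y M r m = (\<lambda>a. r m a + y * carried y M r (Suc m) a)"
proof
  fix a
  have "(\<Sum>l=Suc m..M. y ^ (l - m) * r l a) = (\<Sum>l=Suc m..M. y * (y ^ (l - Suc m) * r l a))"
    by (intro sum.cong refl) (simp add: Suc_diff_le power_Suc[symmetric] mult.assoc[symmetric] Suc_diff_Suc del: power_Suc)
  then show "carried y M r m a = r m a + y * carried y M r (Suc m) a"
    using assms by (simp add: carried_def sum.atLeast_Suc_atMost sum_distrib_left)
qed

abbreviation spin_list :: "spin \<Rightarrow> 'a \<Rightarrow> 'a list" where
  "spin_list s v \<equiv> (if s = Minus then [v] else [])"

text \<open>With at most one incoming particle this is linearity. With two,
  \<open>(r + (x + y) A) \<and> (r + y A) = x (A \<and> r)\<close>, where \<open>\<and>\<close>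
  denotes the wedge, and \<open>x\<close> is the weight \<open>a2\<close>: here the free fermionic
  relation enters. The lists \<open>us\<close> and \<open>ws\<close> stand for columns to the right
  and left of \<open>m\<close>.\<close>

lemma vertex_list_det:
  fixes x y M r m
  defines "w \<equiv> ff_weights x y 1 1"
  assumes "m \<le> M"
  shows "list_det n (us @ spin_list b (moved x y M r m) @ spin_list s (carried y M r m) @ ws) =
    (\<Sum>t\<in>UNIV. \<Sum>s'\<in>UNIV. vertex_weight w s t s' b *
      list_det n (us @ spin_list s' (carried y M r (Suc m)) @ spin_list t (r m) @ ws))"
proof -
  define A where "A = carried y M r (Suc m)"
  have c: "carried y M r m = (\<lambda>a. 1 * r m a + y * A a)" using carried_rec[OF assms(2)] by (simp add: A_def)
  have mv: "moved x y M r m = (\<lambda>a. 1 * r m a + (x + y) * A a)" by (simp add: moved_def A_def)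
  note lin = list_det_linear[of n us 1 "r m" _ A]
  note lin' = list_det_linear[of n "us @ [v]" 1 "r m" _ A ws for v, simplified]
  have both: "list_det n (us @ (\<lambda>a. 1 * r m a + (x + y) * A a) # (\<lambda>a. 1 * r m a + y * A a) # ws) =
      x * list_det n (us @ A # r m # ws)"
    unfolding lin using lin' list_det_swap[of n us "r m" A ws]
    by (simp add: list_det_repeat algebra_simps)
  show ?thesis
  proof (cases "b = Minus \<and> s = Minus")
    case True
    then show ?thesis
      unfolding A_def[symmetric] c mv by (simp add: both sum_spin w_def ff_weights_def del: mult_1)
  next
    case False
    then show ?thesis
      unfolding A_def[symmetric] c mv
      by (cases b; cases s) (simp_all add: lin sum_spin w_def ff_weights_def del: mult_1)
  qed
qed

lemma row_list_det:
  fixes x y M r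
  defines "w \<equiv> ff_weights x y 1 1"
  assumes "m \<le> Suc M"
  shows "list_det n (us @ map (moved x y M r) (occupied m b)) =
    (\<Sum>u\<in>{..<m} \<rightarrow>\<^sub>E UNIV. \<Sum>s\<in>UNIV. row_partial w u b m s *
      list_det n (us @ spin_list s (carried y M r m) @ map r (occupied m u)))"
  using assms(2)
proof (induction m arbitrary: us)
  case 0
  then show ?case by (simp add: sum_spin)
next
  case (Suc m)
  define G where "G u t s' = list_det n (us @ spin_list s' (carried y M r (Suc m)) @
    spin_list t (r m) @ map r (occupied m u))" for u t s'
  have row: "row_partial w (u(m := t)) b m s = row_partial w u b m s" for u t s
    by (rule row_partial_cong) auto
  have map_spin: "map r (spin_list t m) = spin_list t (r m)" for t by simp
  have occ: "occupied m (u(m := t)) = occupied m u" for u t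
    by (rule occupied_cong) auto
  \<comment> \<open>The vector of column \<open>m\<close> is pushed into \<open>us\<close>; the
    induction hypothesis treats the columns to its left and \<open>vertex_list_det\<close> then
    treats column \<open>m\<close> itself.\<close>
  have "list_det n (us @ map (moved x y M r) (occupied (Suc m) b)) =
      list_det n ((us @ spin_list (b m) (moved x y M r m)) @ map (moved x y M r) (occupied m b))"
    by simp
  also have "\<dots> = (\<Sum>u\<in>{..<m} \<rightarrow>\<^sub>E UNIV. \<Sum>s\<in>UNIV. row_partial w u b m s *
      list_det n (us @ spin_list (b m) (moved x y M r m) @ spin_list s (carried y M r m) @
        map r (occupied m u)))"
    using Suc.prems by (subst Suc.IH) auto
  also have "\<dots> = (\<Sum>u\<in>{..<m} \<rightarrow>\<^sub>E UNIV. \<Sum>s\<in>UNIV. row_partial w u b m s *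
      (\<Sum>t\<in>UNIV. \<Sum>s'\<in>UNIV. vertex_weight w s t s' (b m) * G u t s'))"
    using Suc.prems unfolding w_def G_def by (subst vertex_list_det) auto
  also have "\<dots> = (\<Sum>t\<in>UNIV. \<Sum>u\<in>{..<m} \<rightarrow>\<^sub>E UNIV. \<Sum>s'\<in>UNIV.
      (\<Sum>s\<in>UNIV. row_partial w u b m s * vertex_weight w s t s' (b m)) * G u t s')"
    by (simp add: sum_spin sum.distrib algebra_simps)
  also have "\<dots> = (\<Sum>u\<in>{..<Suc m} \<rightarrow>\<^sub>E UNIV. \<Sum>s'\<in>UNIV. row_partial w u b (Suc m) s' *
      list_det n (us @ spin_list s' (carried y M r (Suc m)) @ map r (occupied (Suc m) u)))"
    unfolding lessThan_Suc by (simp add: sum_PiE_insert row occ map_spin G_def)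
  finally show ?case .
qed

text \<open>Beyond column \<open>M\<close> the carried vector is 0, which enforces the spin
  \<open>Plus\<close> on the right boundary.\<close>

lemma full_row_list_det:
  "list_det n (map (moved x y M r) (occupied (Suc M) b)) =
    (\<Sum>u\<in>{..M} \<rightarrow>\<^sub>E UNIV. row_partial (ff_weights x y 1 1) u b (Suc M) Plus *
      list_det n (map r (occupied (Suc M) u)))"
proof -
  have "carried y M r (Suc M) = (\<lambda>a. 0)" by (simp add: carried_def)
  then have "(\<Sum>s\<in>UNIV. row_partial w u b (Suc M) s *
      list_det n ([] @ spin_list s (carried y M r (Suc M)) @ map r (occupied (Suc M) u))) =
      row_partial w u b (Suc M) Plus * list_det n (map r (occupied (Suc M) u))" for w u
    using list_det_zero[of n "[]"] by (simp add: sum_spin del: row_partial.simps occupied.simps)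
  then show ?thesis
    using row_list_det[of "Suc M" M n "[]" x y r b] unfolding lessThan_Suc_atMost by simp
qed

text \<open>The expansion of \<open>(1 + x X) / (1 - y X)\<close>.\<close>

definition row_series :: "complex \<Rightarrow> complex \<Rightarrow> complex fps" where
  "row_series x y = Abs_fps (\<lambda>k. if k = 0 then 1 else (x + y) * y ^ (k - 1))"

text \<open>Applied to the vectors of coefficients of \<open>H\<close>, the map \<open>moved\<close>
  is multiplication by \<open>row_series\<close>. The bound on \<open>p\<close> ensures that the
  columns beyond \<open>M\<close> would contribute only coefficients of negative index.\<close>

lemma int_coeff_mult_row_series:
  assumes "p \<le> int M"
  shows "int_coeff (H * row_series x y) (p - int m) =
    int_coeff H (p - int m) + (x + y) * (\<Sum>l=Suc m..M. y ^ (l - Suc m) * int_coeff H (p - int l))"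
proof (cases "p < int m")
  case True
  then show ?thesis by (simp add: int_coeff_def)
next
  case False
  define k where "k = nat (p - int m)"
  have p: "p = int (m + k)" using False by (simp add: k_def)
  have "int_coeff (H * row_series x y) (p - int m) = (\<Sum>i\<le>k. fps_nth H i * fps_nth (row_series x y) (k - i))"
    by (simp add: int_coeff_def p fps_mult_nth atLeast0AtMost)
  also have "\<dots> = fps_nth H k + (\<Sum>i<k. fps_nth H i * ((x + y) * y ^ (k - i - 1)))"
    by (simp add: lessThan_Suc_atMost[symmetric] row_series_def)
  also have "(\<Sum>i<k. fps_nth H i * ((x + y) * y ^ (k - i - 1))) =
      (x + y) * (\<Sum>i<k. y ^ (k - i - 1) * fps_nth H i)"
    by (simp add: sum_distrib_left ac_simps)
  also have "(\<Sum>i<k. y ^ (k - i - 1) * fps_nth H i) =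
      (\<Sum>l=Suc m..m + k. y ^ (l - Suc m) * int_coeff H (p - int l))"
    by (rule sum.reindex_bij_witness[of _ "\<lambda>l. m + k - l" "\<lambda>i. m + k - i"])
      (auto simp: p int_coeff_def nat_diff_distrib intro!: arg_cong2[where f = "(*)"] arg_cong2[where f = "(^)"] arg_cong2[where f = fps_nth])
  also have "\<dots> = (\<Sum>l=Suc m..M. y ^ (l - Suc m) * int_coeff H (p - int l))"
    using assms by (intro sum.mono_neutral_left) (auto simp: p int_coeff_def)
  finally show ?thesis by (simp add: p int_coeff_def)
qed

section \<open>Normalizing the weights and induction over rows\<close>

lemma vertex_weight_normalized:
  "vertex_weight (ff_weights x y A B) l t r b =
    inverse A * (if t = Minus then inverse B else 1) * vertex_weight (ff_weights x y 1 1) l t r b"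
  by (cases l; cases t; cases r; cases b) (simp_all add: ff_weights_def)

text \<open>Every vertex carries \<open>inverse A\<close>, and exactly those with a
  \<open>Minus\<close> on top carry \<open>inverse B\<close>.\<close>

lemma row_partial_normalized:
  "row_partial (ff_weights x y A B) t b m s =
    inverse A ^ m * inverse B ^ length (occupied m t) * row_partial (ff_weights x y 1 1) t b m s"
proof (induction m arbitrary: s)
  case (Suc m)
  show ?case
    by (simp add: Suc.IH vertex_weight_normalized[of x y A B] sum_distrib_left ac_simps
        del: vertex_weight.simps power_inverse)
qed auto

lemma transfer_list_det:
  fixes x y A B :: "nat \<Rightarrow> complex"
  assumes lam: "strict_partition lam" "largest_part lam \<le> M"
  shows "transfer (\<lambda>i. ff_weights (x i) (y i) (A i) (B i)) M (part_spin lam) N b =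
    (\<Prod>i=1..N. inverse (A i) ^ Suc M * inverse (B i) ^ length lam) *
    list_det (length lam) (map (\<lambda>m a. int_coeff (\<Prod>i=1..N. row_series (x i) (y i))
      (partition_seq lam a - int m)) (occupied (Suc M) b))"
proof (induction N arbitrary: b)
  case 0
  define nu where "nu = occupied (Suc M) b"
  have nu: "strict_partition nu" unfolding nu_def by (rule strict_partition_occupied)
  \<comment> \<open>Without rows the two boundaries must agree, and the determinant with generating
    function 1 is the corresponding delta.\<close>
  have "(\<forall>j\<le>M. part_spin lam j = b j) \<longleftrightarrow> lam = nu"
    using occupied_eq_iff[of "Suc M" "part_spin lam" b] occupied_part_spin[OF lam]
    by (simp only: nu_def less_Suc_eq_le) 
  moreover have "list_det (length lam) (map (\<lambda>m a. int_coeff 1 (partition_seq lam a - int m)) nu) =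
      (if lam = nu then 1 else 0)"
  proof (cases "length nu = length lam")
    case True
    have "list_det (length lam) (map (\<lambda>m a. int_coeff 1 (partition_seq lam a - int m)) nu) =
        leibniz_det (length lam) (\<lambda>i j. if lam ! j = nu ! i then 1 else 0)"
      using True by (auto simp: list_det_def int_coeff_def partition_seq_nth intro!: leibniz_det_cong)
    also have "\<dots> = leibniz_det (length lam) (\<lambda>i j. if lam ! i = nu ! j then 1 else 0)"
      by (rule leibniz_det_transpose)
    finally show ?thesis using leibniz_det_delta[OF lam(1) nu refl True] by simp
  qed (auto simp: list_det_def)
  ultimately show ?case by (simp add: nu_def)
next
  case (Suc N)
  define l where "l = length lam"
  define C where "C = (\<Prod>i=1..N. inverse (A i) ^ Suc M * inverse (B i) ^ l)"
  define H where "H = (\<Prod>i=1..N. row_series (x i) (y i))"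
  define r where "r m a = int_coeff H (partition_seq lam a - int m)" for m a
  \<comment> \<open>Using \<open>partition_seq\<close> instead of the parts gives the bound for
    every index \<open>a\<close>, so \<open>moved\<close> is computed as an equality of
    functions.\<close>
  have le: "partition_seq lam a \<le> int M" for a
    using largest_part_ge[OF lam(1) nth_mem, of a] lam(2) by (auto simp: partition_seq_def)
  have moved: "moved (x (Suc N)) (y (Suc N)) M r m =
      (\<lambda>a. int_coeff (H * row_series (x (Suc N)) (y (Suc N))) (partition_seq lam a - int m))" for m
    unfolding moved_def carried_def r_def int_coeff_mult_row_series[OF le] ..
  have "transfer (\<lambda>i. ff_weights (x i) (y i) (A i) (B i)) M (part_spin lam) (Suc N) b =
      (\<Sum>u\<in>{..M} \<rightarrow>\<^sub>E UNIV. C * list_det l (map r (occupied (Suc M) u)) *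
        (inverse (A (Suc N)) ^ Suc M * inverse (B (Suc N)) ^ length (occupied (Suc M) u) *
          row_partial (ff_weights (x (Suc N)) (y (Suc N)) 1 1) u b (Suc M) Plus))"
    unfolding transfer.simps Suc.IH row_partial_normalized[of _ _ "A (Suc N)" "B (Suc N)"]
    by (simp only: C_def l_def r_def[abs_def] H_def)
  also have "\<dots> = (\<Sum>u\<in>{..M} \<rightarrow>\<^sub>E UNIV. C * (inverse (A (Suc N)) ^ Suc M * inverse (B (Suc N)) ^ l) *
      (row_partial (ff_weights (x (Suc N)) (y (Suc N)) 1 1) u b (Suc M) Plus *
        list_det l (map r (occupied (Suc M) u))))"
    \<comment> \<open>\<open>list_det l\<close> vanishes unless \<open>u\<close> has exactly
      \<open>l\<close> particles, so the exponent of \<open>inverse B\<close> may be replaced by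
      \<open>l\<close>.\<close>
    by (intro sum.cong refl) (simp add: list_det_def del: occupied.simps row_partial.simps power_Suc)
  also have "\<dots> = C * (inverse (A (Suc N)) ^ Suc M * inverse (B (Suc N)) ^ l) *
      list_det l (map (moved (x (Suc N)) (y (Suc N)) M r) (occupied (Suc M) b))"
    unfolding full_row_list_det sum_distrib_left ..
  finally show ?case
    unfolding moved C_def l_def H_def by simp
qed

lemma partition_function_ff:
  assumes lam: "strict_partition lam" "largest_part lam \<le> M"
    and mu: "strict_partition mu" "largest_part mu \<le> M"
  shows "partition_function (\<lambda>i. ff_weights (x i) (y i) (A i) (B i)) N M lam mu =
    (\<Prod>i=1..N. inverse (A i) ^ Suc M * inverse (B i) ^ length lam) *
    (if length lam = length mu then leibniz_det (length lam) (\<lambda>i j.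
      int_coeff (\<Prod>i=1..N. row_series (x i) (y i)) (int (lam ! i) - int (mu ! j))) else 0)"
proof -
  define H where "H = (\<Prod>i=1..N. row_series (x i) (y i))"
  have "list_det (length lam) (map (\<lambda>m a. int_coeff H (partition_seq lam a - int m)) mu) =
      (if length lam = length mu then
        leibniz_det (length lam) (\<lambda>i j. int_coeff H (int (lam ! i) - int (mu ! j))) else 0)"
  proof (cases "length mu = length lam")
    case True
    have "list_det (length lam) (map (\<lambda>m a. int_coeff H (partition_seq lam a - int m)) mu) =
        leibniz_det (length lam) (\<lambda>i j. int_coeff H (int (lam ! j) - int (mu ! i)))"
      using True by (auto simp: list_det_def partition_seq_nth intro!: leibniz_det_cong)
    then show ?thesis
      using True leibniz_det_transpose[of "length lam" "\<lambda>i j. int_coeff H (int (lam ! i) - int (mu ! j))"]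
      by simp
  qed (auto simp: list_det_def)
  then show ?thesis
    unfolding partition_function_transfer transfer_list_det[OF lam] occupied_part_spin[OF mu]
    by (simp only: H_def)
qed

section \<open>Generating functions\<close>

text \<open>The quotient \<open>F / H\<close> has derivative 0 and constant term 1.\<close>

lemma fps_linear_ode_unique:
  fixes F H Q :: "'a::field_char_0 fps"
  assumes F: "fps_deriv F = Q * F" "fps_nth F 0 = 1" and H: "fps_deriv H = Q * H" "fps_nth H 0 = 1"
  shows "F = H"
proof -
  have inv: "inverse H * H = 1" using H by (simp add: inverse_mult_eq_1)
  have "fps_deriv (F * inverse H) = Q * F * inverse H - Q * F * inverse H * (inverse H * H)"
    using F H by (simp add: fps_inverse_deriv power2_eq_square algebra_simps)
  then have "fps_deriv (F * inverse H) = 0" by (simp only: inv mult_1_right diff_self)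
  then have "F * inverse H = fps_const (fps_nth (F * inverse H) 0)" by (simp only: fps_deriv_eq_0_iff)
  moreover have "fps_nth (F * inverse H) 0 = 1"
    using arg_cong[OF inv, of "\<lambda>f. fps_nth f 0"] F(2) H(2) by simp
  ultimately have "F * inverse H = 1" by simp
  then have "F * (inverse H * H) = H" by (metis mult.assoc mult_1)
  then show ?thesis by (simp add: inv)
qed

abbreviation exp_power_sums :: "(nat \<Rightarrow> nat \<Rightarrow> complex) \<Rightarrow> nat \<Rightarrow> complex fps" where
  "exp_power_sums s N \<equiv> fps_exp 1 oo power_sums s N"

lemma exp_power_sums_nth_0: "fps_nth (exp_power_sums s N) 0 = 1"
  by (simp add: fps_compose_nth)

lemma exp_power_sums_deriv:
  "fps_deriv (exp_power_sums s N) = fps_deriv (power_sums s N) * exp_power_sums s N"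
  by (simp add: fps_compose_deriv power_sums_def)

text \<open>The logarithmic derivative recovers the exponent up to its constant term, which is
  0.\<close>

lemma exp_power_sums_inject:
  assumes "exp_power_sums s N = exp_power_sums s' N"
  shows "power_sums s N = power_sums s' N"
proof -
  have "exp_power_sums s' N \<noteq> 0" by (metis exp_power_sums_nth_0 fps_zero_nth zero_neq_one)
  then have "fps_deriv (power_sums s N) = fps_deriv (power_sums s' N)"
    using exp_power_sums_deriv[of s N] exp_power_sums_deriv[of s' N] assms by simp
  then show ?thesis by (simp add: fps_deriv_eq_iff power_sums_def)
qed

text \<open>For \<open>k \<ge> 1\<close>, the coefficient of \<open>X ^ k\<close> in
  \<open>log ((1 + x X) / (1 - y X))\<close>.\<close>

definition ff_param :: "complex \<Rightarrow> complex \<Rightarrow> nat \<Rightarrow> complex" where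
  "ff_param x y k = 1 / of_nat k * (y ^ k + (- 1) ^ (k - 1) * x ^ k)"

text \<open>With \<open>a = 1 - y X\<close> and \<open>b = 1 + x X\<close> the series is
  \<open>g = b / a\<close>, and its logarithmic derivative is \<open>y / a + x / b\<close>.
  \<open>U\<close> and \<open>V\<close> are the geometric series inverting \<open>a\<close> and
  \<open>b\<close>; the claim is checked after multiplication by \<open>a\<close>.\<close>

lemma row_series_deriv:
  "fps_deriv (row_series x y) =
    fps_deriv (Abs_fps (\<lambda>k. if k = 0 then 0 else ff_param x y k)) * row_series x y"
proof -
  define g where "g = row_series x y"
  define a where "a = 1 - fps_const y * fps_X"
  define b where "b = 1 + fps_const x * fps_X"
  define U where "U = Abs_fps (\<lambda>n. y ^ n)"
  define V where "V = Abs_fps (\<lambda>n. (- x) ^ n)"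
  define p where "p = fps_deriv (Abs_fps (\<lambda>k. if k = 0 then 0 else ff_param x y k))"
  have ag: "a * g = b"
  proof (rule fps_ext)
    fix n show "fps_nth (a * g) n = fps_nth b n"
      by (cases n; cases "n - 1") (auto simp: a_def b_def g_def row_series_def left_diff_distrib
          mult.assoc fps_mult_fps_X_plus_1_nth)
  qed
  have aU: "a * U = 1"
  proof (rule fps_ext)
    fix n show "fps_nth (a * U) n = fps_nth 1 n"
      by (cases n) (auto simp: a_def U_def left_diff_distrib mult.assoc)
  qed
  have bV: "b * V = 1"
  proof (rule fps_ext)
    fix n show "fps_nth (b * V) n = fps_nth 1 n"
      by (cases n) (auto simp: b_def V_def distrib_right mult.assoc)
  qed
  have p: "p = fps_const y * U + fps_const x * V"
  proof (rule fps_ext)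
    fix n
    show "fps_nth p n = fps_nth (fps_const y * U + fps_const x * V) n"
      by (simp add: p_def U_def V_def ff_param_def power_minus[of x] del: of_nat_Suc)
  qed
  have "g = U * b" using aU ag by (metis mult.assoc mult.commute mult_1)
  have "fps_deriv (a * g) = fps_const x" by (simp add: ag b_def)
  then have "a * fps_deriv g = fps_const x + fps_const y * g"
    by (simp add: a_def algebra_simps)
  moreover have "a * (p * g) = fps_const x + fps_const y * g"
  proof -
    have "a * (p * g) = p * b" using ag by (metis mult.left_commute)
    also have "\<dots> = fps_const y * (U * b) + fps_const x * (b * V)" by (simp add: p algebra_simps)
    finally show ?thesis using bV \<open>g = U * b\<close> by simp
  qed
  moreover have "a \<noteq> 0" using aU by auto
  ultimately have "fps_deriv g = p * g" by (metis mult_left_cancel)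
  then show ?thesis by (simp add: g_def p_def)
qed

text \<open>Both sides solve the same linear differential equation, because logarithmic derivatives
  add over the rows.\<close>

lemma exp_power_sums_ff:
  assumes "\<And>k j. k \<ge> 1 \<Longrightarrow> j \<ge> 1 \<Longrightarrow> s k j = ff_param (x j) (y j) k"
  shows "exp_power_sums s N = (\<Prod>i=1..N. row_series (x i) (y i))"
proof (rule fps_linear_ode_unique[OF exp_power_sums_deriv exp_power_sums_nth_0])
  show "fps_nth (\<Prod>i=1..N. row_series (x i) (y i)) 0 = 1"
    by (induction N) (simp_all add: row_series_def)
  show "fps_deriv (\<Prod>i=1..N. row_series (x i) (y i)) =
      fps_deriv (power_sums s N) * (\<Prod>i=1..N. row_series (x i) (y i))"
  proof (induction N)
    case 0
    have "power_sums s 0 = 0" by (auto simp: power_sums_def fps_eq_iff)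
    then show ?case by simp
  next
    case (Suc N)
    define S where "S = Abs_fps (\<lambda>k. if k = 0 then 0 else ff_param (x (Suc N)) (y (Suc N)) k)"
    have "power_sums s (Suc N) = power_sums s N + S"
      using assms[of _ "Suc N"] by (auto simp: power_sums_def S_def fps_eq_iff)
    then show ?case
      using Suc.IH row_series_deriv[of "x (Suc N)" "y (Suc N)"] by (simp add: S_def algebra_simps)
  qed
qed

lemma powi_neg_of_nat: "(a :: complex) powi (- int n) = inverse a ^ n"
  by (simp add: power_int_minus power_inverse)

lemma partition_function_bracket:
  assumes "strict_partition lam" "strict_partition mu" "max (largest_part lam) (largest_part mu) \<le> M"
    and "\<And>k j. k \<ge> 1 \<Longrightarrow> j \<ge> 1 \<Longrightarrow> s k j = ff_param (x j) (y j) k"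
  shows "partition_function (\<lambda>i. ff_weights (x i) (y i) (A i) (B i)) N M lam mu =
    (\<Prod>i=1..N. A i powi (- int (M + 1)) * B i powi (- int (length lam))) *
    bracket lam (exp_H_minus s N) mu"
  using assms(3)
  by (simp only: partition_function_ff[OF assms(1) _ assms(2)] bracket_exp_H_minus[OF assms(1,2)]
      exp_power_sums_ff[OF assms(4)] powi_neg_of_nat max.bounded_iff Suc_eq_plus1)

section \<open>Recovering the parameters from one-particle coefficients\<close>

lemma bracket_single: "bracket [k] (exp_H_minus s N) [0] = fps_nth (exp_power_sums s N) k"
  by (simp add: bracket_exp_H_minus strict_partition_def leibniz_det_1 int_coeff_def)

text \<open>One-particle coefficients determine the whole generating function, hence the sum of the
  parameters over the first \<open>N\<close> rows; consecutive \<open>N\<close> isolate a single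
  row. The case \<open>N = 0\<close> is an empty sum.\<close>

lemma params_unique:
  assumes "\<And>N k. N \<ge> 1 \<Longrightarrow>
      bracket [k] (exp_H_minus s N) [0] = bracket [k] (exp_H_minus s' N) [0]"
    and "k \<ge> 1" "j \<ge> 1"
  shows "s k j = s' k j"
proof -
  have eq: "power_sums s N = power_sums s' N" for N
  proof (cases "N = 0")
    case False
    then show ?thesis
      using assms(1)[of N] by (intro exp_power_sums_inject fps_ext) (simp add: bracket_single)
  qed (simp add: power_sums_def fps_eq_iff)
  obtain N where j: "j = Suc N" using \<open>j \<ge> 1\<close> by (cases j) auto
  have "fps_nth (power_sums t (Suc N)) k = fps_nth (power_sums t N) k + t k (Suc N)" for t
    using \<open>k \<ge> 1\<close> by (simp add: power_sums_def)
  then show ?thesis using eq[of N] eq[of "Suc N"] by (metis add_left_cancel j)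
qed

section \<open>Necessity of the free fermionic condition\<close>

lemma transfer_cong:
  assumes "\<And>j. j \<le> M \<Longrightarrow> b j = b' j"
  shows "transfer W M t N b = transfer W M t N b'"
proof (cases N)
  case (Suc N')
  have "row_partial w u b (Suc M) Plus = row_partial w u b' (Suc M) Plus" for w u
    using assms by (intro row_partial_cong) auto
  then show ?thesis by (simp only: Suc transfer.simps)
qed (use assms in auto)

text \<open>The assumed identity starts at \<open>N = 1\<close>; this supplies the empty grid, so
  that the increment argument reaches the first row too.\<close>

lemma transfer_0_bracket:
  assumes "strict_partition lam" "strict_partition mu" "max (largest_part lam) (largest_part mu) \<le> M"
  shows "transfer W M (part_spin lam) 0 (part_spin mu) = bracket lam (exp_H_minus s 0) mu"
proof -
  have "power_sums s 0 = 0" by (simp add: power_sums_def fps_eq_iff)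
  then have "exp_power_sums s 0 = 1" by simp
  then show ?thesis
    using partition_function_ff[OF assms(1) _ assms(2), of M "\<lambda>_. 0" "\<lambda>_. 0" "\<lambda>_. 1" "\<lambda>_. 1" 0] assms(3)
    by (simp add: partition_function_transfer bracket_exp_H_minus[OF assms(1,2)])
qed

section \<open>Explicit row sums on the grid with columns 0, 1, 2\<close>

definition spins3 :: "spin \<Rightarrow> spin \<Rightarrow> spin \<Rightarrow> nat \<Rightarrow> spin" where
  "spins3 s0 s1 s2 = (\<lambda>j. if j = 0 then s0 else if j = 1 then s1 else s2)"

lemma part_spin_spins3:
  "transfer W 2 t N (part_spin mu) =
    transfer W 2 t N (spins3 (part_spin mu 0) (part_spin mu 1) (part_spin mu 2))"
proof (rule transfer_cong)
  fix j :: nat assume "j \<le> 2"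
  then have "j = 0 \<or> j = 1 \<or> j = 2" by auto
  then show "part_spin mu j = spins3 (part_spin mu 0) (part_spin mu 1) (part_spin mu 2) j"
    by (auto simp: spins3_def)
qed

lemma transfer3_Suc:
  "transfer W 2 t (Suc N) b = (\<Sum>s2\<in>UNIV. \<Sum>s1\<in>UNIV. \<Sum>s0\<in>UNIV.
    transfer W 2 t N (spins3 s0 s1 s2) * row_partial (W (Suc N)) (spins3 s0 s1 s2) b 3 Plus)"
proof -
  have three: "{..2::nat} = insert 2 (insert 1 (insert 0 {}))" by auto
  have "((\<lambda>_. undefined)(0 := s0, 1 := s1, 2 := s2)) j = spins3 s0 s1 s2 j" if "j \<le> 2" for s0 s1 s2 and j :: nat
    using that by (auto simp: spins3_def)
  then have eqs: "transfer W 2 t N ((\<lambda>_. undefined)(0 := s0, 1 := s1, 2 := s2)) =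
        transfer W 2 t N (spins3 s0 s1 s2)"
      "row_partial w ((\<lambda>_. undefined)(0 := s0, 1 := s1, 2 := s2)) b 3 Plus =
        row_partial w (spins3 s0 s1 s2) b 3 Plus" for s0 s1 s2 w
    by (intro transfer_cong row_partial_cong; simp)+
  have "(\<Sum>u\<in>{2, 1, 0::nat} \<rightarrow>\<^sub>E UNIV. f u) =
      (\<Sum>s2\<in>UNIV. \<Sum>s1\<in>UNIV. \<Sum>s0\<in>UNIV. f ((\<lambda>_. undefined)(0 := s0, 1 := s1, 2 := s2)))"
    for f :: "(nat \<Rightarrow> spin) \<Rightarrow> complex"
  proof -
    have notin: "(2::nat) \<notin> {1, 0}" "(1::nat) \<notin> {0}" "(0::nat) \<notin> {}" by auto
    have "(\<Sum>u\<in>{a}. g u) = g a" for g :: "(nat \<Rightarrow> spin) \<Rightarrow> complex" and a by simp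
    then show ?thesis
      by (simp only: sum_PiE_insert[OF notin(1)] sum_PiE_insert[OF notin(2)]
          sum_PiE_insert[OF notin(3)] PiE_empty_domain)
  qed
  moreover have "Suc 2 = 3" by simp
  ultimately show ?thesis
    by (simp only: transfer.simps three eqs)
qed

text \<open>Each summand is one path: the particle goes straight up, or turns right by
  \<open>c1\<close>, passes columns by \<open>b2\<close> and turns up by \<open>c2\<close>.\<close>

lemma transfer3_one:
  fixes W N t
  defines "w \<equiv> W (Suc N)" and "Z \<equiv> transfer W 2 t"
  shows "Z (Suc N) (spins3 Plus Minus Plus) =
      Z N (spins3 Plus Minus Plus) * (wa1 w ^ 2 * wb1 w) +
      Z N (spins3 Plus Plus Minus) * (wa1 w * wc1 w * wc2 w)"
    and "Z (Suc N) (spins3 Minus Plus Plus) =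
      Z N (spins3 Minus Plus Plus) * (wa1 w ^ 2 * wb1 w) +
      Z N (spins3 Plus Minus Plus) * (wa1 w * wc1 w * wc2 w) +
      Z N (spins3 Plus Plus Minus) * (wb2 w * wc1 w * wc2 w)"
  unfolding Z_def transfer3_Suc
  by (simp_all add: sum_spin spins3_def numeral_3_eq_3 w_def power2_eq_square algebra_simps del: transfer.simps)

text \<open>The last summand is the only one where a moving particle meets a resting one, which
  brings in \<open>a2\<close>.\<close>

lemma transfer3_two:
  fixes W N t
  defines "w \<equiv> W (Suc N)" and "Z \<equiv> transfer W 2 t"
  shows "Z (Suc N) (spins3 Minus Minus Plus) =
      Z N (spins3 Minus Minus Plus) * (wa1 w * wb1 w ^ 2) +
      Z N (spins3 Minus Plus Minus) * (wb1 w * wc1 w * wc2 w) +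
      Z N (spins3 Plus Minus Minus) * (wa2 w * wc1 w * wc2 w)"
  unfolding Z_def transfer3_Suc
  by (simp_all add: sum_spin spins3_def numeral_3_eq_3 w_def power2_eq_square algebra_simps del: transfer.simps)

lemma free_fermionic_if_bracket:
  assumes nz: "all_weights_nonzero (W (Suc N))"
    and AB: "\<And>i. i \<ge> 1 \<Longrightarrow> A i \<noteq> 0 \<and> B i \<noteq> 0"
      "wa1 (W (Suc N)) = inverse (A (Suc N))" "wb1 (W (Suc N)) = inverse (A (Suc N)) * inverse (B (Suc N))"
    and id: "\<And>lam mu n. strict_partition lam \<Longrightarrow> strict_partition mu \<Longrightarrow>
      max (largest_part lam) (largest_part mu) \<le> 2 \<Longrightarrow>
      transfer W 2 (part_spin lam) n (part_spin mu) =
      (\<Prod>i=1..n. inverse (A i) ^ 3 * inverse (B i) ^ length lam) * bracket lam (exp_H_minus s n) mu"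
  shows "free_fermionic (W (Suc N))"
proof -
  define w where "w = W (Suc N)"
  define Z1 where "Z1 = transfer W 2 (part_spin [2])"
  define Z2 where "Z2 = transfer W 2 (part_spin [2, 1])"
  define h where "h n k = fps_nth (exp_power_sums s n) k" for n k
  define p where "p n = (\<Prod>i=1..n. inverse (A i) ^ 3 * inverse (B i))" for n
  define q where "q n = (\<Prod>i=1..n. inverse (A i) ^ 3 * inverse (B i) ^ 2)" for n
  have pq: "p n \<noteq> 0" "q n \<noteq> 0" for n using AB(1) by (auto simp: p_def q_def)
  have Suc_pq: "p (Suc N) = p N * (wa1 w ^ 2 * wb1 w)" "q (Suc N) = q N * (wa1 w * wb1 w ^ 2)"
    by (simp_all add: p_def q_def w_def AB power2_eq_square power3_eq_cube)
  have h0: "h n 0 = 1" for n unfolding h_def by (rule exp_power_sums_nth_0)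
  note parts = strict_partition_def largest_part_def part_spin_def bracket_exp_H_minus
    leibniz_det_1 leibniz_det_2 int_coeff_def numeral_2_eq_2[symmetric]
  \<comment> \<open>The assumed identity turns every value into a determinant of size 1 or 2; the
    last one is the two-particle coefficient \<open>h n 1 ^ 2 - h n 2\<close>.\<close>
  have Z: "Z1 n (spins3 Plus Plus Minus) = p n" "Z1 n (spins3 Plus Minus Plus) = p n * h n 1"
      "Z1 n (spins3 Minus Plus Plus) = p n * h n 2"
      "Z2 n (spins3 Plus Minus Minus) = q n" "Z2 n (spins3 Minus Plus Minus) = q n * h n 1"
      "Z2 n (spins3 Minus Minus Plus) = q n * (h n 1 ^ 2 - h n 2)" for n
    using id[of "[2]" "[2]" n] id[of "[2]" "[1]" n] id[of "[2]" "[0]" n]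
      id[of "[2, 1]" "[2, 1]" n] id[of "[2, 1]" "[2, 0]" n] id[of "[2, 1]" "[1, 0]" n] h0[of n]
    unfolding part_spin_spins3[of W _ n] Z1_def Z2_def
    by (simp_all add: parts h_def p_def q_def power2_eq_square)
  define c where "c = wc1 w * wc2 w"
  define D where "D = wa1 w * wb1 w"
  have w: "wa1 w \<noteq> 0" "wb1 w \<noteq> 0" "c \<noteq> 0" "D \<noteq> 0"
    using nz by (auto simp: all_weights_nonzero_def w_def c_def D_def)
  have "p N * wa1 w * (h (Suc N) 1 * D) = p N * wa1 w * (h N 1 * D + c)"
    using transfer3_one(1)[of W "part_spin [2]" N, folded Z1_def w_def, unfolded Z Suc_pq]
    unfolding c_def D_def by algebra
  then have e1: "h (Suc N) 1 * D = h N 1 * D + c" using pq w by simp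
  have "p N * (h (Suc N) 2 * (wa1 w * D)) = p N * (h N 2 * (wa1 w * D) + h N 1 * c * wa1 w + c * wb2 w)"
    using transfer3_one(2)[of W "part_spin [2]" N, folded Z1_def w_def, unfolded Z Suc_pq]
    unfolding c_def D_def by algebra
  then have e2: "h (Suc N) 2 * (wa1 w * D) = h N 2 * (wa1 w * D) + h N 1 * c * wa1 w + c * wb2 w"
    using pq by simp
  have "q N * ((h (Suc N) 1 ^ 2 - h (Suc N) 2) * (wb1 w * D)) =
      q N * ((h N 1 ^ 2 - h N 2) * (wb1 w * D) + h N 1 * c * wb1 w + c * wa2 w)"
    using transfer3_two[of W "part_spin [2, 1]" N, folded Z2_def w_def, unfolded Z Suc_pq]
    unfolding c_def D_def by algebra
  then have e3: "(h (Suc N) 1 ^ 2 - h (Suc N) 2) * (wb1 w * D) =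
      (h N 1 ^ 2 - h N 2) * (wb1 w * D) + h N 1 * c * wb1 w + c * wa2 w"
    using pq by simp
  \<comment> \<open>Subtract the identity \<open>h(1)^2 = h(2) + e\<close> for \<open>N\<close> rows
    from that for \<open>N + 1\<close> rows. By \<open>e1\<close>, \<open>h(1)\<close> grows by
    \<open>c / D\<close>; the mixed terms in \<open>h N 1\<close> cancel, leaving \<open>c^2\<close>
    against \<open>c\<close> times the free fermionic sum.\<close>
  have "c * c = c * (wa1 w * wa2 w + wb1 w * wb2 w)"
    using e1 e2 e3 unfolding D_def by algebra
  then show ?thesis using w by (simp add: free_fermionic_def w_def[symmetric] c_def)
qed

theorem theorem4p6:
  shows "(\<forall>(x :: nat \<Rightarrow> complex) (y :: nat \<Rightarrow> complex) (A :: nat \<Rightarrow> complex) (B :: nat \<Rightarrow> complex)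
            (s :: nat \<Rightarrow> nat \<Rightarrow> complex).
            (\<forall>i\<ge>1. A i \<noteq> 0 \<and> B i \<noteq> 0) \<longrightarrow>
            ((\<forall>lam mu N M. strict_partition lam \<and> strict_partition mu \<and> N \<ge> 1 \<and>
                 M \<ge> max (largest_part lam) (largest_part mu) \<longrightarrow>
                 partition_function (\<lambda>i. ff_weights (x i) (y i) (A i) (B i)) N M lam mu =
                 (\<Prod>i=1..N. A i powi (- int (M + 1)) * B i powi (- int (length lam))) *
                 bracket lam (exp_H_minus s N) mu)
             \<longleftrightarrow>
             (\<forall>k\<ge>1. \<forall>j\<ge>1. s k j = 1 / of_nat k * (y j ^ k + (- 1) ^ (k - 1) * x j ^ k))))
       \<and>
         (\<forall>(W :: nat \<Rightarrow> row_weights) (A :: nat \<Rightarrow> complex) (B :: nat \<Rightarrow> complex).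
            (\<forall>i\<ge>1. all_weights_nonzero (W i)) \<longrightarrow>
            (\<forall>i\<ge>1. wa1 (W i) = inverse (A i) \<and> wb1 (W i) = inverse (A i) * inverse (B i)) \<longrightarrow>
            (\<exists>i\<ge>1. \<not> free_fermionic (W i)) \<longrightarrow>
            \<not> (\<exists>s :: nat \<Rightarrow> nat \<Rightarrow> complex.
                 \<forall>lam mu N M. strict_partition lam \<and> strict_partition mu \<and> N \<ge> 1 \<and>
                   M \<ge> max (largest_part lam) (largest_part mu) \<longrightarrow>
                   partition_function W N M lam mu =
                   (\<Prod>i=1..N. A i powi (- int (M + 1)) * B i powi (- int (length lam))) *
                   bracket lam (exp_H_minus s N) mu))"

\<comment> \<open>Comparing determinants for part (a), contradiction from one row for part
  (b)\<close>
proof (intro conjI allI impI)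
  fix x y A B :: "nat \<Rightarrow> complex" and s :: "nat \<Rightarrow> nat \<Rightarrow> complex"
  assume AB: "\<forall>i\<ge>1. A i \<noteq> 0 \<and> B i \<noteq> 0"
  let ?W = "\<lambda>i. ff_weights (x i) (y i) (A i) (B i)"
  let ?C = "\<lambda>N M lam. \<Prod>i=1..N. A i powi (- int (M + 1)) * B i powi (- int (length lam))"
  show "(\<forall>lam mu N M. strict_partition lam \<and> strict_partition mu \<and> N \<ge> 1 \<and>
        M \<ge> max (largest_part lam) (largest_part mu) \<longrightarrow>
        partition_function ?W N M lam mu = ?C N M lam * bracket lam (exp_H_minus s N) mu) \<longleftrightarrow>
      (\<forall>k\<ge>1. \<forall>j\<ge>1. s k j = 1 / of_nat k * (y j ^ k + (- 1) ^ (k - 1) * x j ^ k))"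
    (is "?L \<longleftrightarrow> ?R")
  proof
    assume R: ?R
    show ?L
    proof (intro allI impI, elim conjE)
      fix lam mu N M
      assume "strict_partition lam" "strict_partition mu"
        "max (largest_part lam) (largest_part mu) \<le> M"
      then show "partition_function ?W N M lam mu = ?C N M lam * bracket lam (exp_H_minus s N) mu"
        using partition_function_bracket[of lam mu M s x y A B N] R unfolding ff_param_def by blast
    qed
  next
    assume id: ?L
    \<comment> \<open>The family for which the identity is already known; comparing it with
      \<open>s\<close> on the same partition function and cancelling the nonzero prefactor equates
      the one-particle coefficients.\<close>
    define s' where "s' k j = ff_param (x j) (y j) k" for k j
    have "s k j = s' k j" if "k \<ge> 1" "j \<ge> 1" for k j
    proof (rule params_unique[OF _ that])
      fix N k :: nat
      assume N: "N \<ge> 1"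
      have parts: "strict_partition [k]" "strict_partition [0]"
          "max (largest_part [k]) (largest_part [0]) \<le> k"
        by (simp_all add: strict_partition_def largest_part_def)
      have "?C N k [k] \<noteq> 0" using AB by (auto simp: power_int_eq_0_iff)
      moreover have "?C N k [k] * bracket [k] (exp_H_minus s N) [0] =
          ?C N k [k] * bracket [k] (exp_H_minus s' N) [0]"
        using id[rule_format, of "[k]" "[0]" N k] parts N
          partition_function_bracket[OF parts, of s' x y A B N] by (simp only: s'_def simp_thms)
      ultimately show "bracket [k] (exp_H_minus s N) [0] = bracket [k] (exp_H_minus s' N) [0]"
        by (simp only: mult_cancel_left simp_thms)
    qed
    then show ?R by (simp add: s'_def ff_param_def)
  qed
next
  fix W :: "nat \<Rightarrow> row_weights" and A B :: "nat \<Rightarrow> complex"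
  assume nz: "\<forall>i\<ge>1. all_weights_nonzero (W i)"
    and AB: "\<forall>i\<ge>1. wa1 (W i) = inverse (A i) \<and> wb1 (W i) = inverse (A i) * inverse (B i)"
    and nff: "\<exists>i\<ge>1. \<not> free_fermionic (W i)"
  \<comment> \<open>Since \<open>inverse 0 = 0\<close>, nonzero weights \<open>a1\<close> and
    \<open>b1\<close> force \<open>A i\<close> and \<open>B i\<close> to be nonzero.\<close>
  have AB0: "A i \<noteq> 0 \<and> B i \<noteq> 0" if "i \<ge> 1" for i
    using nz AB that by (force simp: all_weights_nonzero_def)
  obtain N where N: "\<not> free_fermionic (W (Suc N))"
    using nff by (metis Suc_le_D One_nat_def)
  show "\<not> (\<exists>s. \<forall>lam mu N M. strict_partition lam \<and> strict_partition mu \<and> N \<ge> 1 \<and>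
      M \<ge> max (largest_part lam) (largest_part mu) \<longrightarrow>
      partition_function W N M lam mu =
      (\<Prod>i=1..N. A i powi (- int (M + 1)) * B i powi (- int (length lam))) *
      bracket lam (exp_H_minus s N) mu)"
  proof
    assume "\<exists>s. \<forall>lam mu N M. strict_partition lam \<and> strict_partition mu \<and> N \<ge> 1 \<and>
      M \<ge> max (largest_part lam) (largest_part mu) \<longrightarrow>
      partition_function W N M lam mu =
      (\<Prod>i=1..N. A i powi (- int (M + 1)) * B i powi (- int (length lam))) *
      bracket lam (exp_H_minus s N) mu"
    then obtain s where id: "\<And>lam mu N M. strict_partition lam \<Longrightarrow> strict_partition mu \<Longrightarrow> N \<ge> 1 \<Longrightarrow>
      M \<ge> max (largest_part lam) (largest_part mu) \<Longrightarrow>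
      partition_function W N M lam mu =
      (\<Prod>i=1..N. A i powi (- int (M + 1)) * B i powi (- int (length lam))) *
      bracket lam (exp_H_minus s N) mu" by blast
    have "free_fermionic (W (Suc N))"
    proof (rule free_fermionic_if_bracket[where A = A and B = B and s = s])
      fix lam mu n
      assume parts: "strict_partition lam" "strict_partition mu"
        "max (largest_part lam) (largest_part mu) \<le> 2"
      have 3: "(2::nat) + 1 = 3" by simp
      show "transfer W 2 (part_spin lam) n (part_spin mu) =
          (\<Prod>i=1..n. inverse (A i) ^ 3 * inverse (B i) ^ length lam) * bracket lam (exp_H_minus s n) mu"
      proof (cases "n = 0")
        case True
        then show ?thesis using transfer_0_bracket[OF parts] by (simp del: transfer.simps)
      next
        case False
        then show ?thesis
          using id[OF parts(1,2) _ parts(3), of n]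
          unfolding partition_function_transfer powi_neg_of_nat 3 by simp
      qed
    qed (use nz AB AB0 in auto)
    with N show False by contradiction
  qed
qed

end
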